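(* It is undecidable, given a ruleset $\mathcal R$ of existential rules, whether $\mathcal R$ is a finite-partitionwidth set.
   Context: An existential rule is a first-order sentence $\forall\vec x\vec y.(\varphi(\vec x,\vec y)\to\exists\vec z.\psi(\vec y,\vec z))$ with $\varphi,\psi$ conjunctions of atoms over a finite signature (containing the unary predicate $\top$), possibly mentioning constants; a ruleset is a finite set of such rules. A database is a finite set of atoms over constants; an instance is a countable set of atoms over constants and nulls. A model of $(\mathcal D,\mathcal R)$ is an instance containing $\mathcal D$ and satisfying all rules of $\mathcal R$; a universal model is a model that maps homomorphically (identity on constants) into every model. $\mathcal R$ is a finite-partitionwidth set if for every database $\mathcal D$ there exists a universal model of $(\mathcal D,\mathcal R)$ of finite partitionwidth. Partitionwidth: let $\mathbb L$ be a finite set of colors with arities in $\mathbb N_+$, containing $o_i$ of arity $i$ for $1\le i\le$ maximal signature arity. For tuples $\vec a$ ($k$-ary), $\vec b$ ($m$-ary) and $I\subsetneq\{1..k+m\}$ with $|I|=k$, $\vec a\,{+}{+}_I\,\vec b$ places $a_1,\dots,a_k$ in order at positions in $I$ and $b_1,\dots,b_m$ in order elsewhere (elementwise on sets). Instructions: $\mathrm{Add}(\kappa,\mu,I\to\lambda)$, $\mathrm{RAdd}(\kappa,\mu,I\to R)$ (with $\mathrm{ar}\kappa+\mathrm{ar}\mu$ equal to the arity of $\lambda$ resp. $R$, $|I|=\mathrm{ar}\kappa$), $\mathrm{Recol}^i(\kappa\to\lambda)$, $\mathrm{Mat}^i(\kappa\to R)$ ($i\in\{0,1\}$, equal arities);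 Add or $\mathrm{Recol}^i$ instructions differing only in target color are incompatible. A well-decorated tree labels nodes of $\{0,1\}^*$ with sets of decorators from $\{*\}\cup\mathrm{Cnst}\cup$instructions: pseudoleaves ($*$ or a constant) carry nothing else and have undecorated descendants, constants label at most one node, no incompatible instructions at a node. Entities of $s$: nodes $ss'$ labeled $*$ and constants labeling some $ss'$. $\mathrm{col}_s(o_i)$ is $\{(c,..,c)\}$ / $\{(s,..,s)\}$ at a pseudoleaf ($c$ resp. $*$), other colors empty; at other nodes $\mathrm{col}_s(\lambda)$ is the union of $\mathrm{col}_{s0}(\kappa)\,{+}{+}_I\,\mathrm{col}_{s1}(\mu)$ for $\mathrm{Add}(\kappa,\mu,I\to\lambda)$ at $s$, of $\mathrm{col}_{si}(\kappa)$ for $\mathrm{Recol}^i(\kappa\to\lambda)$ at $s$, and of $\mathrm{col}_{si}(\lambda)$ for each $i$ with no $\mathrm{Recol}^i(\lambda\to\cdot)$ at $s$. $\mathrm{Atoms}_s$: $\top$ of the created entity at pseudoleaves; else all $R(\vec e)$ with $\vec e\in\mathrm{col}_{s0}(\kappa)\,{+}{+}_I\,\mathrm{col}_{s1}(\mu)$ for $\mathrm{RAdd}(\kappa,\mu,I\to R)$ at $s$, or $\vec e\in\mathrm{col}_{si}(\kappa)$ for $\mathrm{Mat}^i(\kappa\to R)$ at $s$. An instance has finite partitionwidth if it is isomorphic (bijection of terms fixing constants) to $\bigcup_s\mathrm{Atoms}_s$ for some well-decorated tree over some finite $\mathbb L$. *)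

theory Defs
  imports Main "HOL-Library.Nat_Bijection"
begin

section \<open>Existential rules\<close>

text \<open>A predicate symbol carries its arity: \<open>Pred n k\<close> is the \<open>n\<close>-th predicate of arity \<open>k\<close>.\<close>

datatype pred = Top | Pred nat nat

fun ar :: "pred \<Rightarrow> nat" where
  "ar Top = 1"
| "ar (Pred n k) = k"

definition signature :: "pred set \<Rightarrow> bool" where
  "signature \<Sigma> \<longleftrightarrow> finite \<Sigma> \<and> Top \<in> \<Sigma> \<and> (\<forall>p\<in>\<Sigma>. 1 \<le> ar p)"

type_synonym 't atom = "pred \<times> 't list"

definition atom_over :: "pred set \<Rightarrow> 't atom \<Rightarrow> bool" where
  "atom_over \<Sigma> a \<longleftrightarrow> fst a \<in> \<Sigma> \<and> length (snd a) = ar (fst a)"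

datatype rterm = RVar nat | RConst nat

text \<open>A rule is given by its body and its head, both conjunctions of atoms. The universally
  quantified variables are those of the body; the remaining variables of the head are
  existentially quantified.\<close>

type_synonym rule = "rterm atom list \<times> rterm atom list"

definition rule_over :: "pred set \<Rightarrow> rule \<Rightarrow> bool" where
  "rule_over \<Sigma> r \<longleftrightarrow> (\<forall>a \<in> set (fst r) \<union> set (snd r). atom_over \<Sigma> a)"

definition ruleset_over :: "pred set \<Rightarrow> rule set \<Rightarrow> bool" where
  "ruleset_over \<Sigma> \<R> \<longleftrightarrow> finite \<R> \<and> (\<forall>r\<in>\<R>. rule_over \<Sigma> r)"

definition ruleset :: "rule set \<Rightarrow> bool" where
  "ruleset \<R> \<longleftrightarrow> (\<exists>\<Sigma>. signature \<Sigma> \<and> ruleset_over \<Sigma> \<R>)"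

definition body_vars :: "rule \<Rightarrow> nat set" where
  "body_vars r = {v. \<exists>a \<in> set (fst r). RVar v \<in> set (snd a)}"


section \<open>Instances and universal models\<close>

text \<open>The type of nulls is a parameter: it is \<open>nat\<close> for instances in general (which are thus
  automatically countable) and \<open>bool list\<close> for the instances represented by trees.\<close>

datatype 'n gterm = Const nat | Null 'n

definition terms_of :: "'t atom set \<Rightarrow> 't set" where
  "terms_of I = (\<Union>a\<in>I. set (snd a))"

definition map_atom :: "('s \<Rightarrow> 't) \<Rightarrow> 's atom \<Rightarrow> 't atom" where
  "map_atom h a = (fst a, map h (snd a))"

text \<open>The predicate \<open>Top\<close> is the universal one: it holds for every term of an instance.\<close>

definition inst_over :: "pred set \<Rightarrow> 'n gterm atom set \<Rightarrow> bool" where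
  "inst_over \<Sigma> I \<longleftrightarrow> (\<forall>a\<in>I. atom_over \<Sigma> a) \<and> (\<forall>t\<in>terms_of I. (Top, [t]) \<in> I)"

definition database :: "pred set \<Rightarrow> 'n gterm atom set \<Rightarrow> bool" where
  "database \<Sigma> D \<longleftrightarrow> finite D \<and> (\<forall>a\<in>D. atom_over \<Sigma> a) \<and> terms_of D \<subseteq> range Const"

fun subst :: "(nat \<Rightarrow> 'n gterm) \<Rightarrow> rterm \<Rightarrow> 'n gterm" where
  "subst h (RVar v) = h v"
| "subst h (RConst c) = Const c"

definition sat_rule :: "'n gterm atom set \<Rightarrow> rule \<Rightarrow> bool" where
  "sat_rule I r \<longleftrightarrow>
     (\<forall>h. (\<forall>a \<in> set (fst r). map_atom (subst h) a \<in> I) \<longrightarrow>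
       (\<exists>h'. (\<forall>v \<in> body_vars r. h' v = h v) \<and> (\<forall>a \<in> set (snd r). map_atom (subst h') a \<in> I)))"

definition is_model ::
  "pred set \<Rightarrow> 'n gterm atom set \<Rightarrow> rule set \<Rightarrow> 'n gterm atom set \<Rightarrow> bool" where
  "is_model \<Sigma> D \<R> I \<longleftrightarrow> inst_over \<Sigma> I \<and> D \<subseteq> I \<and> (\<forall>r\<in>\<R>. sat_rule I r)"

definition homomorphism ::
  "('m gterm \<Rightarrow> 'n gterm) \<Rightarrow> 'm gterm atom set \<Rightarrow> 'n gterm atom set \<Rightarrow> bool" where
  "homomorphism h I J \<longleftrightarrow> (\<forall>c. h (Const c) = Const c) \<and> map_atom h ` I \<subseteq> J"

definition universal_model ::
  "pred set \<Rightarrow> 'n gterm atom set \<Rightarrow> rule set \<Rightarrow> 'n gterm atom set \<Rightarrow> bool" where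
  "universal_model \<Sigma> D \<R> U \<longleftrightarrow>
     is_model \<Sigma> D \<R> U \<and> (\<forall>I. is_model \<Sigma> D \<R> I \<longrightarrow> (\<exists>h. homomorphism h U I))"

text \<open>Constants are fixed in both directions, so nulls correspond to nulls.\<close>

definition isomorphic :: "'m gterm atom set \<Rightarrow> 'n gterm atom set \<Rightarrow> bool" where
  "isomorphic I J \<longleftrightarrow>
     (\<exists>f. bij_betw f (terms_of I) (terms_of J) \<and>
          (\<forall>t \<in> terms_of I. \<forall>c. f t = Const c \<longleftrightarrow> t = Const c) \<and>
          map_atom f ` I = J)"


section \<open>Partitionwidth\<close>

datatype color = Origin nat | Color nat nat

fun car :: "color \<Rightarrow> nat" where
  "car (Origin i) = i"
| "car (Color n k) = k"

definition color_set :: "pred set \<Rightarrow> color set \<Rightarrow> bool" where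
  "color_set \<Sigma> L \<longleftrightarrow> finite L \<and> (\<forall>\<kappa>\<in>L. 1 \<le> car \<kappa>) \<and>
     (\<forall>i. Origin i \<in> L \<longleftrightarrow> 1 \<le> i \<and> i \<le> Max (ar ` \<Sigma>))"

text \<open>Tuple positions are counted from 1.\<close>

definition interleave :: "nat set \<Rightarrow> 'a list \<Rightarrow> 'a list \<Rightarrow> 'a list" where
  "interleave I a b =
     map (\<lambda>i. if i \<in> I then a ! card {j. j \<in> I \<and> 1 \<le> j \<and> j < i}
              else b ! card {j. j \<notin> I \<and> 1 \<le> j \<and> j < i})
       [1..<Suc (length a + length b)]"

datatype decorator =
    Star
  | Cnst nat
  | Add color color "nat set" color
  | RAdd color color "nat set" pred
  | Recol bool color color
  | Mat bool color pred

type_synonym node = "bool list"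

fun decorator_over :: "pred set \<Rightarrow> color set \<Rightarrow> decorator \<Rightarrow> bool" where
  "decorator_over \<Sigma> L Star \<longleftrightarrow> True"
| "decorator_over \<Sigma> L (Cnst c) \<longleftrightarrow> True"
| "decorator_over \<Sigma> L (Add \<kappa> \<mu> I \<nu>) \<longleftrightarrow> \<kappa> \<in> L \<and> \<mu> \<in> L \<and> \<nu> \<in> L \<and>
     car \<kappa> + car \<mu> = car \<nu> \<and> I \<subset> {1..car \<nu>} \<and> card I = car \<kappa>"
| "decorator_over \<Sigma> L (RAdd \<kappa> \<mu> I R) \<longleftrightarrow> \<kappa> \<in> L \<and> \<mu> \<in> L \<and> R \<in> \<Sigma> \<and>
     car \<kappa> + car \<mu> = ar R \<and> I \<subset> {1..ar R} \<and> card I = car \<kappa>"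
| "decorator_over \<Sigma> L (Recol i \<kappa> \<nu>) \<longleftrightarrow> \<kappa> \<in> L \<and> \<nu> \<in> L \<and> car \<kappa> = car \<nu>"
| "decorator_over \<Sigma> L (Mat i \<kappa> R) \<longleftrightarrow> \<kappa> \<in> L \<and> R \<in> \<Sigma> \<and> car \<kappa> = ar R"

definition well_decorated :: "pred set \<Rightarrow> color set \<Rightarrow> (node \<Rightarrow> decorator set) \<Rightarrow> bool" where
  "well_decorated \<Sigma> L T \<longleftrightarrow>
     (\<forall>s. \<forall>d \<in> T s. decorator_over \<Sigma> L d) \<and>
     (\<forall>s d. d \<in> T s \<and> (d = Star \<or> (\<exists>c. d = Cnst c)) \<longrightarrow>
        T s = {d} \<and> (\<forall>s'. s' \<noteq> [] \<longrightarrow> T (s @ s') = {})) \<and>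
     (\<forall>c s s'. Cnst c \<in> T s \<and> Cnst c \<in> T s' \<longrightarrow> s = s') \<and>
     (\<forall>s \<kappa> \<mu> I \<nu> \<nu>'. Add \<kappa> \<mu> I \<nu> \<in> T s \<and> Add \<kappa> \<mu> I \<nu>' \<in> T s \<longrightarrow> \<nu> = \<nu>') \<and>
     (\<forall>s i \<kappa> \<nu> \<nu>'. Recol i \<kappa> \<nu> \<in> T s \<and> Recol i \<kappa> \<nu>' \<in> T s \<longrightarrow> \<nu> = \<nu>')"

definition creates :: "(node \<Rightarrow> decorator set) \<Rightarrow> node \<Rightarrow> node gterm \<Rightarrow> bool" where
  "creates T s e \<longleftrightarrow> (Star \<in> T s \<and> e = Null s) \<or> (\<exists>c. Cnst c \<in> T s \<and> e = Const c)"

definition pseudoleaf :: "(node \<Rightarrow> decorator set) \<Rightarrow> node \<Rightarrow> bool" where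
  "pseudoleaf T s \<longleftrightarrow> (\<exists>e. creates T s e)"

text \<open>\<open>has_col L T s \<nu> e\<close> says that \<open>e\<close> is one of the tuples of color \<open>\<nu>\<close> at \<open>s\<close>. The equations for
  these sets refer to the children of \<open>s\<close> in a possibly infinite tree. As a tuple of color \<open>\<nu>\<close> at
  \<open>s\<close> may only contain entities of \<open>s\<close>, which all lie at finite depth below \<open>s\<close>, the
  equations have exactly one solution, the least one.\<close>

inductive has_col ::
  "color set \<Rightarrow> (node \<Rightarrow> decorator set) \<Rightarrow> node \<Rightarrow> color \<Rightarrow> node gterm list \<Rightarrow> bool"
  for L T where
  leaf: "creates T s e \<Longrightarrow> Origin i \<in> L \<Longrightarrow> has_col L T s (Origin i) (replicate i e)"
| add: "\<not> pseudoleaf T s \<Longrightarrow> Add \<kappa> \<mu> I \<nu> \<in> T s \<Longrightarrow>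
     has_col L T (s @ [False]) \<kappa> a \<Longrightarrow> has_col L T (s @ [True]) \<mu> b \<Longrightarrow>
     has_col L T s \<nu> (interleave I a b)"
| recol: "\<not> pseudoleaf T s \<Longrightarrow> Recol i \<kappa> \<nu> \<in> T s \<Longrightarrow>
     has_col L T (s @ [i]) \<kappa> a \<Longrightarrow> has_col L T s \<nu> a"
| keep: "\<not> pseudoleaf T s \<Longrightarrow> (\<nexists>\<kappa>. Recol i \<nu> \<kappa> \<in> T s) \<Longrightarrow>
     has_col L T (s @ [i]) \<nu> a \<Longrightarrow> has_col L T s \<nu> a"

definition atoms_at ::
  "color set \<Rightarrow> (node \<Rightarrow> decorator set) \<Rightarrow> node \<Rightarrow> node gterm atom set" where
  "atoms_at L T s =
     (if pseudoleaf T s then {(Top, [e]) | e. creates T s e}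
      else {(R, interleave I a b) | \<kappa> \<mu> I R a b. RAdd \<kappa> \<mu> I R \<in> T s \<and>
              has_col L T (s @ [False]) \<kappa> a \<and> has_col L T (s @ [True]) \<mu> b}
         \<union> {(R, a) | i \<kappa> R a. Mat i \<kappa> R \<in> T s \<and> has_col L T (s @ [i]) \<kappa> a})"

definition tree_instance ::
  "color set \<Rightarrow> (node \<Rightarrow> decorator set) \<Rightarrow> node gterm atom set" where
  "tree_instance L T = (\<Union>s. atoms_at L T s)"

definition finite_partitionwidth :: "pred set \<Rightarrow> 'n gterm atom set \<Rightarrow> bool" where
  "finite_partitionwidth \<Sigma> I \<longleftrightarrow>
     (\<exists>L T. color_set \<Sigma> L \<and> well_decorated \<Sigma> L T \<and> isomorphic I (tree_instance L T))"

definition finite_partitionwidth_set :: "rule set \<Rightarrow> bool" where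
  "finite_partitionwidth_set \<R> \<longleftrightarrow>
     (\<forall>\<Sigma>. signature \<Sigma> \<and> ruleset_over \<Sigma> \<R> \<longrightarrow>
       (\<forall>D :: nat gterm atom set. database \<Sigma> D \<longrightarrow>
         (\<exists>U. universal_model \<Sigma> D \<R> U \<and> finite_partitionwidth \<Sigma> U)))"


section \<open>Decidability\<close>

text \<open>Partial recursive functions over the natural numbers. \<open>reval f xs y\<close> says that \<open>f\<close> is
  defined on the arguments \<open>xs\<close>, with value \<open>y\<close>.\<close>

datatype recf =
    Zero
  | Succ
  | Proj nat
  | Comp recf "recf list"
  | PrimRec recf recf
  | Mu recf

inductive reval :: "recf \<Rightarrow> nat list \<Rightarrow> nat \<Rightarrow> bool" where
  zero: "reval Zero xs 0"
| succ: "reval Succ [x] (Suc x)"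
| proj: "i < length xs \<Longrightarrow> reval (Proj i) xs (xs ! i)"
| comp: "list_all2 (\<lambda>g y. reval g xs y) gs ys \<Longrightarrow> reval f ys z \<Longrightarrow> reval (Comp f gs) xs z"
| prim0: "reval f xs y \<Longrightarrow> reval (PrimRec f g) (0 # xs) y"
| primS: "reval (PrimRec f g) (n # xs) r \<Longrightarrow> reval g (n # r # xs) y \<Longrightarrow>
    reval (PrimRec f g) (Suc n # xs) y"
| mu: "reval f (n # xs) 0 \<Longrightarrow> (\<forall>m<n. \<exists>y>0. reval f (m # xs) y) \<Longrightarrow> reval (Mu f) xs n"

lemma reval_functional: "reval f xs y \<Longrightarrow> reval f xs z \<Longrightarrow> y = z"
proof (induction arbitrary: z rule: reval.induct)
  case (zero xs)
  then show ?case by cases simp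
next
  case (succ x)
  then show ?case by cases simp
next
  case (proj i xs)
  from proj.prems show ?case by cases simp
next
  case (comp xs gs ys f w)
  from comp.prems obtain ys' where
    ys': "list_all2 (\<lambda>g y. reval g xs y) gs ys'" "reval f ys' z"
    by cases
  have "length ys = length ys'"
    using list_all2_lengthD[OF comp.IH(1)] list_all2_lengthD[OF ys'(1)] by simp
  moreover have "ys ! i = ys' ! i" if "i < length ys" for i
    using comp.IH(1) ys'(1) that by (simp add: list_all2_conv_all_nth)
  ultimately have "ys = ys'" by (rule nth_equalityI)
  with ys'(2) comp.IH(2) show ?case by blast
next
  case (prim0 f xs y g)
  from prim0.prems have "reval f xs z" by cases
  with prim0.IH show ?case by blast
next
  case (primS f g n xs r y)
  from primS.prems obtain r' where "reval (PrimRec f g) (n # xs) r'" "reval g (n # r' # xs) z"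
    by cases
  with primS.IH show ?case by blast
next
  case (mu f n xs)
  from mu.prems have z1: "reval f (z # xs) 0" by cases
  from mu.prems have z2: "\<forall>m<z. \<exists>y>0. reval f (m # xs) y" by cases
  have "\<not> z < n" using mu.IH(2) z1 by fastforce
  moreover have "\<not> n < z" using mu.IH(1) z2 by fastforce
  ultimately show ?case by simp
qed

text \<open>A decision problem consists of the set \<open>W\<close> of its inputs, an encoding of inputs as natural
  numbers, and the property \<open>P\<close> to be decided.\<close>

definition decidable :: "('a \<Rightarrow> nat) \<Rightarrow> 'a set \<Rightarrow> ('a \<Rightarrow> bool) \<Rightarrow> bool" where
  "decidable enc W P \<longleftrightarrow> (\<exists>f. \<forall>x\<in>W. reval f [enc x] (if P x then 1 else 0))"

text \<open>Goedel numbering of rulesets, a ruleset being written down as a list of rules.\<close>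

fun pred_code :: "pred \<Rightarrow> nat" where
  "pred_code Top = 0"
| "pred_code (Pred n k) = Suc (prod_encode (n, k))"

fun rterm_code :: "rterm \<Rightarrow> nat" where
  "rterm_code (RVar v) = sum_encode (Inl v)"
| "rterm_code (RConst c) = sum_encode (Inr c)"

definition atom_code :: "rterm atom \<Rightarrow> nat" where
  "atom_code a = prod_encode (pred_code (fst a), list_encode (map rterm_code (snd a)))"

definition rule_code :: "rule \<Rightarrow> nat" where
  "rule_code r =
     prod_encode (list_encode (map atom_code (fst r)), list_encode (map atom_code (snd r)))"

definition ruleset_code :: "rule list \<Rightarrow> nat" where
  "ruleset_code rs = list_encode (map rule_code rs)"

lemma inj_ruleset_code: "inj ruleset_code"
proof -
  have p: "inj pred_code"
  proof (rule injI)
    fix x y assume "pred_code x = pred_code y" then show "x = y"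
      by (cases x; cases y) (auto simp: prod_encode_eq)
  qed
  have t: "inj rterm_code"
  proof (rule injI)
    fix x y assume "rterm_code x = rterm_code y" then show "x = y"
      by (cases x; cases y) (auto simp: sum_encode_eq)
  qed
  have a: "inj atom_code"
    by (rule injI) (auto simp: atom_code_def prod_encode_eq list_encode_eq prod_eq_iff
        inj_map_eq_map[OF t] inj_eq[OF p])
  have r: "inj rule_code"
    by (rule injI) (auto simp: rule_code_def prod_encode_eq list_encode_eq prod_eq_iff
        inj_map_eq_map[OF a])
  show ?thesis
    by (rule injI) (simp add: ruleset_code_def list_encode_eq inj_map_eq_map[OF r])
qed

end

theory Submission
  imports Defs "HOL-Library.Countable"
begin

text \<open>To a recursive function \<open>q\<close> we associate a ruleset that generates the natural numbers,
  evaluates \<open>q\<close> on an input \<open>n\<close> by Datalog rules and creates, for every pair of terms, a term that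
  is joined to both by an edge. If \<open>q\<close> takes the value 0 on \<open>n\<close>, then all atoms over all terms are
  derived, so every database has a finite universal model, which has finite partitionwidth.
  Otherwise every universal model for the empty database maps to the standard model on the natural
  numbers, and the edges force infinite partitionwidth.

  The input \<open>n\<close> is contained in a single rule that is put in front of the others. Hence the code
  of the ruleset for \<open>q\<close> with its own code \<open>b\<close> as input is computable from \<open>b\<close>, and applying the
  construction to the composition of an alleged decision procedure with this computation yields a
  ruleset on which the procedure errs.\<close>


section \<open>Computing the code of a ruleset with built-in input\<close>

text \<open>The two halves ask different things of the evaluation rules. Otherwise one database
  suffices, and soundness is checked in a single model. Undecidability of halting is not
  presupposed: the answer 0, denying finite partitionwidth, is what triggers the collapse, and so it
  refutes itself.

  The edges work because a cut of the tree leaves only finitely many types of entities, namely the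
  sets of unary colors that they have at the cut, and a binary atom across the cut depends on the
  inner entity only through its type. Vertices for all pairs defeat this. In the standard model the
  pairing function \<open>prod_encode\<close> names these vertices, so that none has more than two
  predecessors.\<close>

definition computable :: "nat \<Rightarrow> (nat list \<Rightarrow> nat) \<Rightarrow> bool" where
  "computable k g \<longleftrightarrow> (\<exists>f. \<forall>xs. length xs = k \<longrightarrow> reval f xs (g xs))"

lemma computable_nth: "i < k \<Longrightarrow> computable k (\<lambda>xs. xs ! i)"
  unfolding computable_def by (rule exI[of _ "Proj i"]) (auto intro: reval.proj)

lemma computable_comp1:
  assumes "computable 1 h" "computable k f"
  shows "computable k (\<lambda>xs. h [f xs])"
proof -
  from assms obtain p q where
    "\<forall>xs. length xs = 1 \<longrightarrow> reval p xs (h xs)" "\<forall>xs. length xs = k \<longrightarrow> reval q xs (f xs)"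
    unfolding computable_def by blast
  then show ?thesis
    unfolding computable_def
    by (intro exI[of _ "Comp p [q]"] allI impI reval.comp[of _ _ "[f _]"]) auto
qed

lemma computable_comp2:
  assumes "computable 2 h" "computable k f" "computable k g"
  shows "computable k (\<lambda>xs. h [f xs, g xs])"
proof -
  from assms obtain p q r where
    "\<forall>xs. length xs = 2 \<longrightarrow> reval p xs (h xs)" "\<forall>xs. length xs = k \<longrightarrow> reval q xs (f xs)"
    "\<forall>xs. length xs = k \<longrightarrow> reval r xs (g xs)"
    unfolding computable_def by blast
  then show ?thesis
    unfolding computable_def
    by (intro exI[of _ "Comp p [q, r]"] allI impI reval.comp[of _ _ "[f _, g _]"]) auto
qed

lemma computable_Suc: "computable k f \<Longrightarrow> computable k (\<lambda>xs. Suc (f xs))"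
proof -
  have "computable 1 (\<lambda>xs. Suc (hd xs))"
    unfolding computable_def
    by (rule exI[of _ Succ]) (auto simp: length_Suc_conv intro: reval.succ)
  then show "computable k f \<Longrightarrow> computable k (\<lambda>xs. Suc (f xs))"
    using computable_comp1 by fastforce
qed

lemma computable_const: "computable k (\<lambda>_. c)"
proof (induction c)
  case 0
  show ?case unfolding computable_def by (rule exI[of _ Zero]) (auto intro: reval.zero)
qed (rule computable_Suc)

text \<open>The recursion equations are hypotheses, so that existing functions such as
  \<open>triangle\<close> need not be rewritten by a recursor.\<close>

lemma computable_primrec:
  assumes base: "computable k f" and step: "computable (Suc (Suc k)) g"
    and h0: "\<And>xs. length xs = k \<Longrightarrow> h (0 # xs) = f xs"
    and hS: "\<And>n xs. length xs = k \<Longrightarrow> h (Suc n # xs) = g (n # h (n # xs) # xs)"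
  shows "computable (Suc k) h"
proof -
  from base step obtain p q where
    p: "\<forall>xs. length xs = k \<longrightarrow> reval p xs (f xs)" and
    q: "\<forall>xs. length xs = Suc (Suc k) \<longrightarrow> reval q xs (g xs)"
    unfolding computable_def by blast
  have "reval (PrimRec p q) (n # xs) (h (n # xs))" if "length xs = k" for n xs
  proof (induction n)
    case 0
    then show ?case using p that by (auto simp: h0 intro: reval.prim0)
  next
    case (Suc n)
    then show ?case using q that by (auto simp: hS intro: reval.primS)
  qed
  then show ?thesis
    unfolding computable_def by (intro exI[of _ "PrimRec p q"]) (auto simp: length_Suc_conv)
qed

lemma computable_add:
  assumes "computable k f" "computable k g"
  shows "computable k (\<lambda>xs. f xs + g xs)"
proof -
  have "computable (Suc 1) (\<lambda>xs. xs ! 0 + xs ! 1)"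
    by (rule computable_primrec[OF computable_nth[of 0] computable_Suc[OF computable_nth[of 1]]])
      auto
  then show ?thesis
    using computable_comp2[OF _ assms] by (fastforce simp: numeral_2_eq_2)
qed

lemma computable_triangle:
  assumes "computable k f"
  shows "computable k (\<lambda>xs. triangle (f xs))"
proof -
  have "computable (Suc 0) (\<lambda>xs. triangle (xs ! 0))"
    by (rule computable_primrec[where f = "\<lambda>_. 0" and g = "\<lambda>xs. xs ! 1 + Suc (xs ! 0)"])
      (auto intro!: computable_add computable_Suc computable_nth computable_const)
  then show ?thesis
    using computable_comp1[OF _ assms] by fastforce
qed

lemma computable_prod_encode:
  assumes "computable k f" "computable k g"
  shows "computable k (\<lambda>xs. prod_encode (f xs, g xs))"
  by (simp add: prod_encode_def assms computable_add computable_triangle)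

definition zeroP :: pred where "zeroP = Pred 0 1"
definition succP :: pred where "succP = Pred 1 2"
definition inputP :: pred where "inputP = Pred 2 1"

text \<open>Variable \<open>i\<close> stands for the number \<open>i\<close>. The unary notation
  adds one atom per step, and at the front, so that the code of the list is a primitive recursion
  along \<open>list_encode\<close>.\<close>

fun path :: "nat \<Rightarrow> rterm atom list" where
  "path 0 = [(zeroP, [RVar 0])]"
| "path (Suc n) = (succP, [RVar n, RVar (Suc n)]) # path n"

text \<open>With an empty body all variables are existential: every model has a chain from some zero
  to the input, and this zero need not be the constant one.\<close>

definition input_rule :: "nat \<Rightarrow> rule" where
  "input_rule n = ([], (inputP, [RVar n]) # path n)"

lemma computable_path: "computable (Suc 0) (\<lambda>xs. list_encode (map atom_code (path (xs ! 0))))"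
proof (rule computable_primrec)
  \<comment> \<open>\<open>RVar v\<close> has code \<open>2 * v\<close>, hence \<open>?v xs\<close>
    and \<open>Suc (Suc (?v xs))\<close> are the codes of the variables \<open>n\<close> and
    \<open>Suc n\<close> for \<open>n = xs ! 0\<close>; \<open>xs ! 1\<close> is the code of the
    atoms of \<open>path n\<close>.\<close>
  let ?v = "\<lambda>xs :: nat list. xs ! 0 + xs ! 0"
  show "computable 0 (\<lambda>_. list_encode (map atom_code (path 0)))"
    by (rule computable_const)
  show "computable (Suc (Suc 0)) (\<lambda>xs. Suc (prod_encode
    (prod_encode (pred_code succP, Suc (prod_encode (?v xs,
        Suc (prod_encode (Suc (Suc (?v xs)), 0))))), xs ! 1)))"
    by (intro computable_Suc computable_prod_encode computable_add computable_const
        computable_nth) auto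
qed (auto simp: atom_code_def sum_encode_def mult_2)

text \<open>\<open>list_encode\<close> forms a nonempty list by
  \<open>Suc (prod_encode ...)\<close>. So the value is the code of the ruleset with code
  \<open>b\<close> after \<open>input_rule b\<close> has been put in front: \<open>b\<close> serves
  both as input and as tail.\<close>

lemma computable_cons_input_rule:
  "\<exists>f. \<forall>b. reval f [b] (Suc (prod_encode (rule_code (input_rule b), b)))"
proof -
  have "computable (Suc 0) (\<lambda>xs. Suc (prod_encode (prod_encode (0, Suc (prod_encode
      (prod_encode (pred_code inputP, Suc (prod_encode (xs ! 0 + xs ! 0, 0))),
       list_encode (map atom_code (path (xs ! 0)))))), xs ! 0)))"
    by (intro computable_Suc computable_prod_encode computable_add computable_const
        computable_nth computable_path) auto
  then obtain f where "\<forall>xs. length xs = Suc 0 \<longrightarrow> reval f xs (Suc (prod_encode (prod_encode (0, Suc (prod_encode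
      (prod_encode (pred_code inputP, Suc (prod_encode (xs ! 0 + xs ! 0, 0))),
       list_encode (map atom_code (path (xs ! 0)))))), xs ! 0)))"
    unfolding computable_def by blast
  then have "reval f [b] (Suc (prod_encode (rule_code (input_rule b), b)))" for b
    by (auto dest!: spec[of _ "[b]"]
        simp: rule_code_def input_rule_def atom_code_def sum_encode_def mult_2)
  then show ?thesis by blast
qed


section \<open>Interleaving of tuples\<close>

lemma length_interleave: "length (interleave I a b) = length a + length b"
  by (simp add: interleave_def del: upt_Suc)

text \<open>The positions counted leave out \<open>i\<close> itself, so the index read in the first
  tuple is in range. Out of range \<open>!\<close> is unspecified, and \<open>map_interleave\<close>
  and \<open>set_interleave\<close> depend on avoiding this.\<close>

lemma interleave_index_left:
  fixes I :: "nat set"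
  assumes "I \<subset> {1..m}" "i \<in> I"
  shows "card {j. j \<in> I \<and> 1 \<le> j \<and> j < i} < card I"
proof (rule psubset_card_mono)
  show "finite I" using assms(1) finite_subset by blast
  show "{j. j \<in> I \<and> 1 \<le> j \<and> j < i} \<subset> I" using assms(2) by blast
qed

lemma interleave_index_right:
  fixes I :: "nat set"
  assumes I: "I \<subset> {1..m}" and i: "1 \<le> i" "i \<le> m" "i \<notin> I"
  shows "card {j. j \<notin> I \<and> 1 \<le> j \<and> j < i} < m - card I"
proof -
  have "i \<in> {1..m} - I" using i by simp
  moreover have "{j. j \<notin> I \<and> 1 \<le> j \<and> j < i} \<subseteq> {1..m} - I" using i(2) by auto
  ultimately have "{j. j \<notin> I \<and> 1 \<le> j \<and> j < i} \<subset> {1..m} - I" by blast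
  then have "card {j. j \<notin> I \<and> 1 \<le> j \<and> j < i} < card ({1..m} - I)"
    by (rule psubset_card_mono[rotated]) simp
  also have "\<dots> = m - card I"
    using I finite_subset[of I "{1..m}"] by (simp add: card_Diff_subset psubset_imp_subset)
  finally show ?thesis .
qed

lemma map_interleave:
  assumes "I \<subset> {1..length a + length b}" "card I = length a"
  shows "map f (interleave I a b) = interleave I (map f a) (map f b)"
  using interleave_index_left[OF assms(1)] interleave_index_right[OF assms(1)] assms(2)
  unfolding interleave_def by (auto simp del: upt_Suc)

lemma set_interleave:
  assumes "I \<subset> {1..length a + length b}" "card I = length a"
  shows "set (interleave I a b) \<subseteq> set a \<union> set b"
  using interleave_index_left[OF assms(1)] interleave_index_right[OF assms(1)] assms(2)
  unfolding interleave_def by (auto simp del: upt_Suc)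

lemma interleave_singletons:
  assumes "I \<subset> {1..2}" "card I = 1"
  shows "interleave I [p] [q] = (if 1 \<in> I then [p, q] else [q, p])"
proof -
  from assms(2) obtain i where i: "I = {i}" by (auto simp: card_1_singleton_iff)
  with assms(1) have "i \<in> {1..2}" by blast
  then have "i = 1 \<or> i = 2" by (simp add: numeral_2_eq_2) linarith
  moreover have "interleave {1} [p] [q] = [p, q]"
  proof -
    have *: "{j. j = Suc 0 \<and> Suc 0 \<le> j \<and> j = 0} = {}"
      "{j. j \<noteq> Suc 0 \<and> Suc 0 \<le> j \<and> j < Suc (Suc 0)} = {}" by auto
    show ?thesis by (simp add: interleave_def upt_conv_Cons *)
  qed
  moreover have "interleave {2} [p] [q] = [q, p]"
  proof -
    have *: "{j. j \<noteq> Suc (Suc 0) \<and> Suc 0 \<le> j \<and> j = 0} = {}"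
      "{j. j = Suc (Suc 0) \<and> Suc 0 \<le> j \<and> j < Suc (Suc 0)} = {}" by auto
    show ?thesis by (simp add: interleave_def upt_conv_Cons * numeral_2_eq_2)
  qed
  ultimately show ?thesis using i by (elim disjE) simp_all
qed

text \<open>The number of hits before \<open>j\<close> is the length of the filtered prefix, which
  is where \<open>t ! j\<close> stands in the filtered list.\<close>

lemma filter_nth_card:
  assumes "j < length t" "P (t ! j)"
  shows "filter P t ! card {i. i < j \<and> P (t ! i)} = t ! j"
proof -
  have t: "t = take j t @ t ! j # drop (Suc j) t" using assms(1) by (rule id_take_nth_drop)
  have "card {i. i < j \<and> P (t ! i)} = card {i. i < length (take j t) \<and> P (take j t ! i)}"
    using assms(1) by (intro arg_cong[where f = card]) auto
  also have "\<dots> = length (filter P (take j t))" by (simp only: length_filter_conv_card)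
  finally have "card {i. i < j \<and> P (t ! i)} = length (filter P (take j t))" .
  moreover have "filter P t = filter P (take j t) @ t ! j # filter P (drop (Suc j) t)"
    using assms(2) by (subst t) simp
  ultimately show ?thesis by simp
qed

lemma card_shifted:
  fixes P :: "nat \<Rightarrow> bool"
  shows "card {i. P (i - 1) \<and> 1 \<le> i \<and> i \<le> n} = card {j. j < n \<and> P j}"
proof -
  have "{i. P (i - 1) \<and> 1 \<le> i \<and> i \<le> n} = Suc ` {j. j < n \<and> P j}"
  proof
    show "{i. P (i - 1) \<and> 1 \<le> i \<and> i \<le> n} \<subseteq> Suc ` {j. j < n \<and> P j}"
    proof
      fix i assume "i \<in> {i. P (i - 1) \<and> 1 \<le> i \<and> i \<le> n}"
      then have "i = Suc (i - 1)" "i - 1 \<in> {j. j < n \<and> P j}" by auto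
      then show "i \<in> Suc ` {j. j < n \<and> P j}" by (rule image_eqI)
    qed
  qed auto
  then show ?thesis by (simp add: card_image)
qed

text \<open>Used for splitting off from a tuple all copies of one constant, which is how the spine
  tree for finite instances builds tuples.\<close>

lemma interleave_filter:
  defines "I \<equiv> \<lambda>P t. {i. P (t ! (i - 1)) \<and> 1 \<le> i \<and> i \<le> length t}"
  shows "interleave (I P t) (filter P t) (filter (\<lambda>x. \<not> P x) t) = t"
    and "card (I P t) = length (filter P t)"
proof -
  show "card (I P t) = length (filter P t)"
    unfolding I_def length_filter_conv_card by (rule card_shifted)
  show "interleave (I P t) (filter P t) (filter (\<lambda>x. \<not> P x) t) = t"
  proof (rule nth_equalityI)
    show len: "length (interleave (I P t) (filter P t) (filter (\<lambda>x. \<not> P x) t)) = length t"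
      by (simp add: length_interleave sum_length_filter_compl)
    fix j assume "j < length (interleave (I P t) (filter P t) (filter (\<lambda>x. \<not> P x) t))"
    with len have j: "j < length t" by simp
    have in_I: "Suc j \<in> I P t \<longleftrightarrow> P (t ! j)" using j by (simp add: I_def)
    have "{i. i \<in> I P t \<and> 1 \<le> i \<and> i < Suc j} = {i. P (t ! (i - 1)) \<and> 1 \<le> i \<and> i \<le> j}"
      using j by (auto simp: I_def)
    then have l: "card {i. i \<in> I P t \<and> 1 \<le> i \<and> i < Suc j} = card {i. i < j \<and> P (t ! i)}"
      using card_shifted[of "\<lambda>i. P (t ! i)" j] by simp
    have "{i. i \<notin> I P t \<and> 1 \<le> i \<and> i < Suc j} = {i. \<not> P (t ! (i - 1)) \<and> 1 \<le> i \<and> i \<le> j}"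
      using j by (auto simp: I_def)
    then have r: "card {i. i \<notin> I P t \<and> 1 \<le> i \<and> i < Suc j} = card {i. i < j \<and> \<not> P (t ! i)}"
      using card_shifted[of "\<lambda>i. \<not> P (t ! i)" j] by simp
    have "interleave (I P t) (filter P t) (filter (\<lambda>x. \<not> P x) t) ! j =
      (if P (t ! j) then filter P t ! card {i. i < j \<and> P (t ! i)}
       else filter (\<lambda>x. \<not> P x) t ! card {i. i < j \<and> \<not> P (t ! i)})"
      using j in_I l r unfolding interleave_def
      by (simp add: sum_length_filter_compl del: upt_Suc)
    also have "\<dots> = t ! j"
      using filter_nth_card[of j t P] filter_nth_card[of j t "\<lambda>x. \<not> P x"] j by simp
    finally show "interleave (I P t) (filter P t) (filter (\<lambda>x. \<not> P x) t) ! j = t ! j" .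
  qed
qed


section \<open>A lower bound for partitionwidth\<close>

definition entity :: "(node \<Rightarrow> decorator set) \<Rightarrow> node \<Rightarrow> node gterm \<Rightarrow> bool" where
  "entity T s e \<longleftrightarrow> (\<exists>u. creates T (s @ u) e)"

lemma entity_append: "entity T (s @ u) e \<Longrightarrow> entity T s e"
  unfolding entity_def by (metis append.assoc)

lemma entity_cases:
  assumes "entity T s e"
  obtains "creates T s e" | i where "entity T (s @ [i]) e"
proof -
  from assms obtain u where u: "creates T (s @ u) e"
    unfolding entity_def by blast
  show ?thesis
  proof (cases u)
    case Nil
    with u that show ?thesis by simp
  next
    case (Cons i u')
    with u have "entity T (s @ [i]) e" unfolding entity_def by auto
    with that show ?thesis by blast
  qed
qed

locale decorated_tree =
  fixes \<Sigma> L T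
  assumes color_set: "color_set \<Sigma> L" and well_decorated: "well_decorated \<Sigma> L T"
begin

text \<open>A null carries the name of its node, and a constant labels at most one node.\<close>

lemma creates_unique: "creates T s e \<Longrightarrow> creates T s' e \<Longrightarrow> s = s'"
  using well_decorated unfolding well_decorated_def creates_def by fastforce

lemma created_unique: "creates T s e \<Longrightarrow> creates T s e' \<Longrightarrow> e = e'"
  using well_decorated unfolding well_decorated_def creates_def by fastforce

text \<open>Both nodes are prefixes of the unique node that creates \<open>e\<close>.\<close>

lemma entities_comparable:
  assumes "entity T s e" "entity T s' e"
  shows "(\<exists>u. s' = s @ u) \<or> (\<exists>u. s = s' @ u)"
proof -
  from assms obtain u v where "creates T (s @ u) e" "creates T (s' @ v) e"
    unfolding entity_def by blast
  then have "s @ u = s' @ v" by (rule creates_unique)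
  then show ?thesis by (auto simp: append_eq_append_conv2)
qed

lemma decorator_over: "d \<in> T s \<Longrightarrow> decorator_over \<Sigma> L d"
  using well_decorated unfolding well_decorated_def by blast

lemma car_pos: "\<kappa> \<in> L \<Longrightarrow> 1 \<le> car \<kappa>"
  using color_set unfolding color_set_def by blast

lemma has_col_length: "has_col L T s \<nu> a \<Longrightarrow> length a = car \<nu>"
proof (induction rule: has_col.induct)
  case (add s \<kappa> \<mu> I \<nu> a b)
  with decorator_over[OF add.hyps(2)] show ?case by (simp add: length_interleave)
next
  case (recol s i \<kappa> \<nu> a)
  with decorator_over[OF recol.hyps(2)] show ?case by simp
qed auto

lemma has_col_entity: "has_col L T s \<nu> a \<Longrightarrow> e \<in> set a \<Longrightarrow> entity T s e"
proof (induction rule: has_col.induct)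
  case (leaf s e' i)
  then show ?case unfolding entity_def by (auto intro: exI[of _ "[]"])
next
  case (add s \<kappa> \<mu> I \<nu> a b)
  have "e \<in> set a \<union> set b"
    using add.prems set_interleave[of I a b] decorator_over[OF add.hyps(2)]
      has_col_length[OF add.hyps(3)] has_col_length[OF add.hyps(4)] by auto
  then show ?case using add.IH entity_append by blast
qed (use entity_append in blast)+

text \<open>Colors have positive arity, so a pair is composed of two singletons, possibly swapped;
  \<open>i\<close> records the swap. The second conclusion concerns arbitrary \<open>p\<close> and
  \<open>q\<close>, so that one component can be replaced later.\<close>

lemma interleave_eq_pair:
  assumes I: "I \<subset> {1..n}" "card I = car \<kappa>" "car \<kappa> + car \<mu> = n" "\<kappa> \<in> L" "\<mu> \<in> L"
    and a: "has_col L T (s @ [False]) \<kappa> a" and b: "has_col L T (s @ [True]) \<mu> b"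
    and xy: "interleave I a b = [x, y]"
  obtains i where "if i then a = [y] \<and> b = [x] else a = [x] \<and> b = [y]"
    "\<And>p q :: node gterm. interleave I [p] [q] = (if i then [q, p] else [p, q])"
proof -
  have "length a + length b = 2" using arg_cong[OF xy, of length] by (simp add: length_interleave)
  then have len: "length a = 1" "length b = 1"
    using has_col_length[OF a] has_col_length[OF b] car_pos[OF I(4)] car_pos[OF I(5)] by linarith+
  then obtain p q where pq: "a = [p]" "b = [q]" by (auto simp: length_Suc_conv)
  have "I \<subset> {1..2}" "card I = 1"
    using I(1-3) len has_col_length[OF a] has_col_length[OF b] by (simp_all add: numeral_2_eq_2)
  note * = interleave_singletons[OF this]
  show ?thesis
  proof (cases "1 \<in> I")
    case True
    show ?thesis by (rule that[of False]) (use True xy[unfolded pq *] pq * in simp_all)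
  next
    case False
    show ?thesis by (rule that[of True]) (use False xy[unfolded pq *] pq * in simp_all)
  qed
qed

text \<open>The finite fingerprint of an entity at a cut. Unary colors suffice, since a pair with
  one component outside the subtree of \<open>s\<close> is assembled above \<open>s\<close> from
  singletons.\<close>

definition color_type :: "node \<Rightarrow> node gterm \<Rightarrow> color set" where
  "color_type s e = {\<nu> \<in> L. has_col L T s \<nu> [e]}"

lemma has_col_in_L: "has_col L T s \<nu> a \<Longrightarrow> \<nu> \<in> L"
  by (induction rule: has_col.induct) (auto dest: decorator_over)

lemma color_type_eqD:
  "color_type s e = color_type s e' \<Longrightarrow> has_col L T s \<nu> [e] \<Longrightarrow> has_col L T s \<nu> [e']"
  using has_col_in_L unfolding color_type_def by blast

context
  fixes s x x'
  assumes x: "entity T s x" and x': "entity T s x'" and types: "color_type s x = color_type s x'"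
begin

text \<open>\<open>s\<close> and \<open>p @ [i]\<close> both contain \<open>x\<close> and are
  therefore comparable, and \<open>s\<close> lies strictly below \<open>p\<close>.\<close>

lemma child_towards:
  assumes "s = p @ u" "entity T (p @ [i]) x" "u \<noteq> []"
  shows "\<exists>u'. s = (p @ [i]) @ u'"
  using entities_comparable[OF x assms(2)] assms(1,3)
  by (cases u) (auto simp: append_eq_append_conv2 append_eq_Cons_conv)

text \<open>On the way up from \<open>s\<close> a singleton is only recolored or kept:
  \<open>Add\<close> yields arity at least 2, and \<open>leaf\<close> applies only at the creator of
  \<open>x\<close>, which lies at or below \<open>s\<close>. So the type at \<open>s\<close> decides
  the colors above.\<close>

lemma has_col_exchange1:
  assumes "has_col L T p \<nu> a" "a = [x]" "s = p @ u"
  shows "has_col L T p \<nu> [x']"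
proof (cases "u = []")
  case True
  then show ?thesis using assms color_type_eqD[OF types] by simp
next
  case False
  show ?thesis using assms False
  proof (induction arbitrary: u rule: has_col.induct)
    case (leaf p e i)
    then have p: "creates T p x" by (cases i) simp_all
    obtain v where "creates T (s @ v) x" using x unfolding entity_def by blast
    with p have "p = s @ v" by (rule creates_unique)
    with leaf.prems have False by simp
    then show ?case ..
  next
    case (add p \<kappa> \<mu> I \<nu> a b)
    have "length a + length b = 1"
      using arg_cong[OF add.prems(1), of length] by (simp add: length_interleave)
    moreover have "length a \<ge> 1" "length b \<ge> 1"
      using has_col_length[OF add.hyps(3)] has_col_length[OF add.hyps(4)] car_pos
        decorator_over[OF add.hyps(2)] by auto
    ultimately show ?case by simp
  next
    case (recol p i \<kappa> \<nu> a)
    have "entity T (p @ [i]) x" using has_col_entity[OF recol.hyps(3)] recol.prems by simp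
    from child_towards[OF recol.prems(2) this recol.prems(3)] obtain u' where
      u': "s = (p @ [i]) @ u'" by blast
    have "has_col L T (p @ [i]) \<kappa> [x']"
      using recol.IH[OF recol.prems(1) u'] color_type_eqD[OF types] recol.hyps(3) recol.prems(1) u'
      by (cases "u' = []") auto
    with recol.hyps show ?case by (blast intro: has_col.recol)
  next
    case (keep p i \<nu> a)
    have "entity T (p @ [i]) x" using has_col_entity[OF keep.hyps(3)] keep.prems by simp
    from child_towards[OF keep.prems(2) this keep.prems(3)] obtain u' where
      u': "s = (p @ [i]) @ u'" by blast
    have "has_col L T (p @ [i]) \<nu> [x']"
      using keep.IH[OF keep.prems(1) u'] color_type_eqD[OF types] keep.hyps(3) keep.prems(1) u'
      by (cases "u' = []") auto
    with keep.hyps show ?case by (blast intro: has_col.keep)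
  qed
qed

context
  fixes y
  assumes y: "\<not> entity T s y"
begin

text \<open>\<open>s\<close> and \<open>p\<close> are comparable, and \<open>p\<close> cannot lie at
  or below \<open>s\<close>, whose subtree lacks \<open>y\<close>.\<close>

lemma strictly_above:
  assumes "entity T p x" "entity T p y"
  obtains u where "s = p @ u" "u \<noteq> []"
  using entities_comparable[OF x assms(1)] y assms(2) entity_append by fastforce

text \<open>The common step for \<open>Add\<close> and \<open>RAdd\<close>: the child contributing
  \<open>x\<close> is \<open>s\<close> or lies above it, so \<open>x'\<close> has the same color
  there, and the contribution of \<open>y\<close> is left as it is. The flag \<open>f\<close> puts
  \<open>y\<close> first.\<close>

lemma exchange_children:
  assumes a: "has_col L T (p @ [False]) \<kappa> a" and b: "has_col L T (p @ [True]) \<mu> b"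
    and I: "I \<subset> {1..n}" "card I = car \<kappa>" "car \<kappa> + car \<mu> = n" "\<kappa> \<in> L" "\<mu> \<in> L"
    and ab: "interleave I a b = (if f then [y, x] else [x, y])"
  shows "\<exists>a' b'. has_col L T (p @ [False]) \<kappa> a' \<and> has_col L T (p @ [True]) \<mu> b' \<and>
    interleave I a' b' = (if f then [y, x'] else [x', y])"
proof -
  have above: "\<exists>u. s = (p @ [i]) @ u" if xy: "entity T (p @ [i]) x" "entity T (p @ [j]) y" for i j
  proof -
    obtain u where "s = p @ u" "u \<noteq> []"
      using strictly_above[OF xy[THEN entity_append]] by blast
    then show ?thesis using child_towards xy by blast
  qed
  have ab': "interleave I a b = [if f then y else x, if f then x else y]"
    using ab by simp
  obtain i where i: "if i then a = [if f then x else y] \<and> b = [if f then y else x]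
      else a = [if f then y else x] \<and> b = [if f then x else y]"
    and il: "\<And>p q :: node gterm. interleave I [p] [q] = (if i then [q, p] else [p, q])"
    using interleave_eq_pair[OF I a b ab'] by blast
  \<comment> \<open>\<open>i\<close> swaps the children and \<open>f\<close> swaps the pair, so
    \<open>x\<close> comes from the left child exactly if they agree.\<close>
  show ?thesis
  proof (cases "i = f")
    case True
    with i have eq: "a = [x]" "b = [y]" by (auto split: if_splits)
    then have "entity T (p @ [False]) x" "entity T (p @ [True]) y"
      using has_col_entity a b by auto
    with above obtain u where "s = (p @ [False]) @ u" by blast
    with has_col_exchange1[OF a eq(1)] have "has_col L T (p @ [False]) \<kappa> [x']" by blast
    moreover have "interleave I [x'] [y] = (if f then [y, x'] else [x', y])"
      by (simp add: il True)
    ultimately show ?thesis using b eq by blast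
  next
    case False
    with i have eq: "a = [y]" "b = [x]" by (auto split: if_splits)
    then have "entity T (p @ [False]) y" "entity T (p @ [True]) x"
      using has_col_entity a b by auto
    with above obtain u where "s = (p @ [True]) @ u" by blast
    with has_col_exchange1[OF b eq(2)] have "has_col L T (p @ [True]) \<mu> [x']" by blast
    moreover have "interleave I [y] [x'] = (if f then [y, x'] else [x', y])"
      using False by (simp add: il)
    ultimately show ?thesis using a eq by blast
  qed
qed

text \<open>A pair arises at an \<open>Add\<close>, where \<open>exchange_children\<close> applies,
  and is then only passed on. A leaf yields only tuples with equal entries, but \<open>x\<close>
  lies below \<open>s\<close> and \<open>y\<close> does not.\<close>

lemma has_col_exchange2:
  assumes "has_col L T p \<nu> a" "a = (if f then [y, x] else [x, y])"
  shows "has_col L T p \<nu> (if f then [y, x'] else [x', y])"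
  using assms
proof (induction rule: has_col.induct)
  case (leaf p e i)
  then have "x \<in> set (replicate i e)" "y \<in> set (replicate i e)" by auto
  then have "x = y" by (metis in_set_replicate)
  with x y show ?case by simp
next
  case (add p \<kappa> \<mu> I \<nu> a b)
  have "I \<subset> {1..car \<nu>}" "card I = car \<kappa>" "car \<kappa> + car \<mu> = car \<nu>" "\<kappa> \<in> L" "\<mu> \<in> L"
    using decorator_over[OF add.hyps(2)] unfolding decorator_over.simps by blast+
  from exchange_children[OF add.hyps(3,4) this add.prems]
  obtain a' b' where "has_col L T (p @ [False]) \<kappa> a'" "has_col L T (p @ [True]) \<mu> b'"
    "interleave I a' b' = (if f then [y, x'] else [x', y])" by blast
  with has_col.add[OF add.hyps(1,2)] show ?case by metis
next
  case (recol p i \<kappa> \<nu> a)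
  then show ?case by (blast intro: has_col.recol)
next
  case (keep p i \<nu> a)
  then show ?case by (blast intro: has_col.keep)
qed

text \<open>Pseudoleaves yield only unary atoms, so a binary one comes from \<open>RAdd\<close> or
  \<open>Mat\<close> and inherits the exchange from the colors. Hence an entity outside the cut
  cannot tell \<open>x\<close> from \<open>x'\<close>.\<close>

lemma tree_instance_exchange:
  assumes "(R, if f then [y, x] else [x, y]) \<in> tree_instance L T"
  shows "(R, if f then [y, x'] else [x', y]) \<in> tree_instance L T"
proof -
  from assms obtain p where p: "(R, if f then [y, x] else [x, y]) \<in> atoms_at L T p"
    unfolding tree_instance_def by blast
  have np: "\<not> pseudoleaf T p"
  proof
    assume "pseudoleaf T p"
    with p show False by (auto simp: atoms_at_def split: if_splits)
  qed
  with p consider \<kappa> \<mu> I a b where "RAdd \<kappa> \<mu> I R \<in> T p"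
      "has_col L T (p @ [False]) \<kappa> a" "has_col L T (p @ [True]) \<mu> b"
      "interleave I a b = (if f then [y, x] else [x, y])"
    | i \<kappa> where "Mat i \<kappa> R \<in> T p" "has_col L T (p @ [i]) \<kappa> (if f then [y, x] else [x, y])"
    unfolding atoms_at_def by auto
  then have "(R, if f then [y, x'] else [x', y]) \<in> atoms_at L T p"
  proof cases
    case 1
    have "I \<subset> {1..ar R}" "card I = car \<kappa>" "car \<kappa> + car \<mu> = ar R" "\<kappa> \<in> L" "\<mu> \<in> L"
      using decorator_over[OF 1(1)] unfolding decorator_over.simps by blast+
    from exchange_children[OF 1(2,3) this 1(4)]
    obtain a' b' where "has_col L T (p @ [False]) \<kappa> a'" "has_col L T (p @ [True]) \<mu> b'"
      "interleave I a' b' = (if f then [y, x'] else [x', y])" by blast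
    with np 1(1) show ?thesis unfolding atoms_at_def by (simp del: if_split) metis
  next
    case 2
    from has_col_exchange2[OF 2(2) refl] np 2(1) show ?thesis
      unfolding atoms_at_def by auto
  qed
  then show ?thesis unfolding tree_instance_def by blast
qed

end

end

lemma terms_of_tree_instance: "e \<in> terms_of (tree_instance L T) \<Longrightarrow> entity T [] e"
proof -
  assume "e \<in> terms_of (tree_instance L T)"
  then obtain p R t where t: "(R, t) \<in> atoms_at L T p" "e \<in> set t"
    unfolding terms_of_def tree_instance_def by auto
  have "entity T p e"
  proof (cases "pseudoleaf T p")
    case True
    with t show ?thesis unfolding atoms_at_def entity_def by (auto intro!: exI[of _ "[]"])
  next
    case False
    with t consider \<kappa> \<mu> I a b where "RAdd \<kappa> \<mu> I R \<in> T p"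
      "has_col L T (p @ [False]) \<kappa> a" "has_col L T (p @ [True]) \<mu> b" "t = interleave I a b"
    | i \<kappa> where "has_col L T (p @ [i]) \<kappa> t"
      unfolding atoms_at_def by auto
    then show ?thesis
    proof cases
      case 1
      have "e \<in> set a \<union> set b"
        using t(2) 1(4) set_interleave[of I a b] decorator_over[OF 1(1)]
          has_col_length[OF 1(2)] has_col_length[OF 1(3)] by auto
      with has_col_entity 1(2,3) entity_append show ?thesis by blast
    next
      case 2
      with has_col_entity entity_append t(2) show ?thesis by blast
    qed
  qed
  then show "entity T [] e" using entity_append[of T "[]" p] by simp
qed

text \<open>The argument of Koenig's lemma: a node creates at most one entity, so one of its two
  subtrees retains infinitely many.\<close>

lemma infinite_below:
  assumes "infinite A" "\<And>e. e \<in> A \<Longrightarrow> entity T [] e"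
  shows "\<exists>s. length s = n \<and> infinite {e \<in> A. entity T s e}"
proof (induction n)
  case 0
  have "{e \<in> A. entity T [] e} = A" using assms(2) by blast
  with assms(1) show ?case by auto
next
  case (Suc n)
  then obtain s where s: "length s = n" "infinite {e \<in> A. entity T s e}" by blast
  have "{e \<in> A. entity T s e} \<subseteq> {e. creates T s e} \<union>
      {e \<in> A. entity T (s @ [False]) e} \<union> {e \<in> A. entity T (s @ [True]) e}"
  proof
    fix e assume e: "e \<in> {e \<in> A. entity T s e}"
    then have "entity T s e" by blast
    then show "e \<in> {e. creates T s e} \<union>
      {e \<in> A. entity T (s @ [False]) e} \<union> {e \<in> A. entity T (s @ [True]) e}"
    proof (cases rule: entity_cases)
      case (2 i)
      with e show ?thesis by (cases i) auto
    qed blast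
  qed
  moreover have "finite {e. creates T s e}"
  proof (cases "\<exists>e. creates T s e")
    case True
    then obtain e where "creates T s e" by blast
    then have "{e. creates T s e} \<subseteq> {e}" using created_unique by blast
    then show ?thesis using finite_subset by blast
  qed simp
  ultimately have "infinite {e \<in> A. entity T (s @ [False]) e} \<or>
      infinite {e \<in> A. entity T (s @ [True]) e}"
    using s(2) by (meson finite_Un finite_subset)
  with s(1) show ?case by (metis length_append_singleton)
qed

text \<open>Beyond the depth at which the members of \<open>F\<close> are created no subtree
  contains any of them, and \<open>infinite_below\<close> still finds a rich one there.\<close>

lemma ex_cut:
  assumes "infinite A" "\<And>e. e \<in> A \<Longrightarrow> entity T [] e" "finite F" "F \<subseteq> A"
  shows "\<exists>s. infinite {e \<in> A. entity T s e} \<and> (\<forall>e\<in>F. \<not> entity T s e)"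
proof -
  have "\<forall>e\<in>F. \<exists>v. creates T v e" using assms(2,4) unfolding entity_def by auto
  then obtain v where v: "\<And>e. e \<in> F \<Longrightarrow> creates T (v e) e" by metis
  \<comment> \<open>\<open>insert 0\<close> covers an empty \<open>F\<close>, and \<open>Suc\<close>
    places the cut strictly deeper than all creators.\<close>
  define n where "n = Suc (Max (insert 0 ((\<lambda>e. length (v e)) ` F)))"
  have n: "length (v e) < n" if "e \<in> F" for e
    unfolding n_def less_Suc_eq_le using that assms(3) by (intro Max_ge) auto
  obtain s where s: "length s = n" "infinite {e \<in> A. entity T s e}"
    using infinite_below[OF assms(1,2)] by blast
  have "\<not> entity T s e" if "e \<in> F" for e
  proof
    assume "entity T s e"
    then obtain u where "creates T (s @ u) e" unfolding entity_def by blast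
    with v[OF that] have "v e = s @ u" by (rule creates_unique)
    with n[OF that] s(1) show False by simp
  qed
  with s show ?thesis by blast
qed

text \<open>At a cut of the tree, pigeonholing yields two elements \<open>x\<close>, \<open>x'\<close> inside that no outside
  element can tell apart, and two elements \<open>w\<close>, \<open>w'\<close> outside that no inside element can tell apart.
  A vertex joined to \<open>x\<close> and \<open>w\<close> only can then be neither inside nor outside.\<close>

lemma no_pair_vertices:
  assumes A: "infinite A" "A \<subseteq> terms_of (tree_instance L T)"
    and pairs: "\<And>x w. x \<in> A \<Longrightarrow> w \<in> A \<Longrightarrow> x \<noteq> w \<Longrightarrow> \<exists>z.
      (R, [x, z]) \<in> tree_instance L T \<and> (R, [w, z]) \<in> tree_instance L T \<and>
      (\<forall>y\<in>A. (R, [y, z]) \<in> tree_instance L T \<longrightarrow> y = x \<or> y = w)"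
  shows False
proof -
  have ent: "\<And>e. e \<in> A \<Longrightarrow> entity T [] e" using A(2) terms_of_tree_instance by blast
  have finL: "finite L" using color_set unfolding color_set_def by blast
  \<comment> \<open>A bound on the number of values of \<open>out\<close> below, which are sets of
    types.\<close>
  define K where "K = card (Pow (Pow L))"
  obtain F where F: "F \<subseteq> A" "finite F" "card F = Suc K"
    using infinite_arbitrarily_large[OF A(1)] by blast
  obtain s where s: "infinite {e \<in> A. entity T s e}" "\<forall>e\<in>F. \<not> entity T s e"
    using ex_cut[OF A(1) ent F(2,1)] by blast
  have "\<not> inj_on (color_type s) {e \<in> A. entity T s e}"
  proof
    assume "inj_on (color_type s) {e \<in> A. entity T s e}"
    moreover have "color_type s ` {e \<in> A. entity T s e} \<subseteq> Pow L"
      unfolding color_type_def by blast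
    ultimately have "finite {e \<in> A. entity T s e}"
      using finL by (meson finite_Pow_iff inj_on_finite)
    with s(1) show False ..
  qed
  then obtain x x' where x: "x \<in> A" "entity T s x" "x' \<in> A" "entity T s x'" "x \<noteq> x'"
      "color_type s x = color_type s x'"
    unfolding inj_on_def by blast
  \<comment> \<open>Recording only the types of inner neighbors leaves finitely many values, and by
    exchange the types decide the edges.\<close>
  define out where
    "out w = {color_type s z | z. entity T s z \<and> (R, [w, z]) \<in> tree_instance L T}" for w
  have "\<not> inj_on out F"
  proof
    assume "inj_on out F"
    moreover have "out ` F \<subseteq> Pow (Pow L)" unfolding out_def color_type_def by blast
    ultimately have "card F \<le> K" unfolding K_def using finL by (intro card_inj_on_le) auto
    with F(3) show False by simp
  qed
  then obtain w w' where w: "w \<in> F" "w' \<in> F" "w \<noteq> w'" "out w = out w'"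
    unfolding inj_on_def by blast
  have wA: "w \<in> A" "w' \<in> A" and wout: "\<not> entity T s w" "\<not> entity T s w'"
    using w(1,2) F(1) s(2) by auto
  have ne: "x \<noteq> w" "x' \<noteq> w" "x \<noteq> w'" using x wout by auto
  obtain z where z: "(R, [x, z]) \<in> tree_instance L T" "(R, [w, z]) \<in> tree_instance L T"
      "\<And>y. y \<in> A \<Longrightarrow> (R, [y, z]) \<in> tree_instance L T \<Longrightarrow> y = x \<or> y = w"
    using pairs[OF x(1) wA(1) ne(1)] by blast
  show False
  proof (cases "entity T s z")
    case False
    have "(R, [x', z]) \<in> tree_instance L T"
      using tree_instance_exchange[OF x(2,4,6) False, of R False] z(1) by simp
    with z(3) x(3,5) ne show False by blast
  next
    \<comment> \<open>\<open>w'\<close> has an inner neighbor \<open>z'\<close> of the type of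
      \<open>z\<close>; exchanging \<open>z'\<close> for \<open>z\<close> makes \<open>w'\<close> a
      third vertex joined to \<open>z\<close>.\<close>
    case True
    then have "color_type s z \<in> out w'" using z(2) w(4) unfolding out_def by blast
    then obtain z' where z': "color_type s z = color_type s z'" "entity T s z'"
        "(R, [w', z']) \<in> tree_instance L T"
      unfolding out_def by blast
    have "(R, [w', z]) \<in> tree_instance L T"
      using tree_instance_exchange[OF z'(2) True z'(1)[symmetric] wout(2), of R True] z'(3) by simp
    with z(3) wA(2) w(3) ne show False by blast
  qed
qed

end


section \<open>Finite instances have finite partitionwidth\<close>

lemma ground_list: "set ts \<subseteq> range Const \<Longrightarrow> \<exists>t. ts = map Const t"
  by (induction ts) (auto intro: exI[of _ "_ # _"])

text \<open>\<open>Suc\<close> starts the spine at the right child of the root, which keeps the root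
  free for the \<open>Mat\<close> instructions.\<close>

definition spine :: "nat \<Rightarrow> node" where
  "spine i = replicate (Suc i) True"

definition rib :: "nat \<Rightarrow> node" where
  "rib i = spine i @ [False]"

lemma rib_eq: "rib i @ u = rib j @ v \<longleftrightarrow> i = j \<and> u = v"
proof (induction i arbitrary: j)
  case 0
  show ?case by (cases j) (auto simp: rib_def spine_def)
next
  case (Suc i)
  then show ?case by (cases j) (auto simp: rib_def spine_def)
qed

lemma rib_eq_rib[simp]: "rib i = rib j \<longleftrightarrow> i = j"
  using rib_eq[of i "[]" j "[]"] by simp

lemma rib_neq_spine: "rib i @ u \<noteq> spine j"
  unfolding rib_def spine_def by (metis append.assoc append_Cons in_set_conv_decomp in_set_replicate)

lemma rib_neq_spine'[simp]: "rib i \<noteq> spine j" "spine j \<noteq> rib i"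
  using rib_neq_spine[of i "[]" j] by auto

lemma spine_eq_spine[simp]: "spine i = spine j \<longleftrightarrow> i = j"
  by (auto simp: spine_def)

lemma spine_neq_Nil[simp]: "spine i \<noteq> []" "[] \<noteq> spine i" "rib i \<noteq> []" "[] \<noteq> rib i"
  by (simp_all add: spine_def rib_def)

lemma spine_append[simp]: "spine i @ [False] = rib i" "spine i @ [True] = spine (Suc i)"
  by (simp_all add: rib_def) (simp add: spine_def replicate_append_same)

definition tuple_color :: "nat list \<Rightarrow> color" where
  "tuple_color t = Color (list_encode t) (length t)"

lemma car_tuple_color[simp]: "car (tuple_color t) = length t"
  by (simp add: tuple_color_def)

lemma tuple_color_eq[simp]: "tuple_color t = tuple_color t' \<longleftrightarrow> t = t'"
  by (auto simp: tuple_color_def list_encode_eq)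

lemma tuple_color_neq[simp]: "tuple_color t \<noteq> Origin k" "Origin k \<noteq> tuple_color t"
  by (simp_all add: tuple_color_def)

lemma has_col_creates: "has_col L T s \<nu> a \<Longrightarrow> \<exists>u e. creates T (s @ u) e"
proof (induction rule: has_col.induct)
  case (leaf s e i)
  then have "creates T (s @ []) e" by simp
  then show ?case by blast
qed (metis append.assoc)+

text \<open>Instructions require a proper subset of the positions, which is why \<open>b\<close>
  must not be empty.\<close>

lemma proper_positions:
  "b \<noteq> [] \<Longrightarrow> I \<subseteq> {1..k + length b} \<Longrightarrow> card I = k \<Longrightarrow> I \<subset> {1..k + length b}"
  by (cases "I = {1..k + length b}") auto

text \<open>The constants of \<open>cs\<close> hang off an infinite spine. Every tuple over those at or below the
  \<open>i\<close>-th vertebra has a color of its own there, so that all atoms can be added at the root.\<close>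

locale ground_instance =
  fixes \<Sigma> and U :: "'n gterm atom set" and cs :: "nat list"
  assumes sig: "signature \<Sigma>" and inst: "inst_over \<Sigma> U"
    and cs: "distinct cs" "terms_of U = Const ` set cs"
begin

definition max_ar :: nat where
  "max_ar = Max (ar ` \<Sigma>)"

definition colors :: "color set" where
  "colors = Origin ` {1..max_ar} \<union>
     tuple_color ` {t. set t \<subseteq> set cs \<and> length t \<le> max_ar \<and> t \<noteq> []}"

text \<open>At a vertebra, \<open>Recol\<close> produces the tuples made of \<open>cs ! i\<close>
  alone, and \<open>Add\<close> those that mix \<open>k\<close> copies of \<open>cs ! i\<close> with
  a tuple \<open>b\<close> from further down. Tuples without \<open>cs ! i\<close> are kept by
  default, as there is no \<open>Recol True\<close>.\<close>

definition tree :: "node \<Rightarrow> decorator set" where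
  "tree s =
     {Mat True (tuple_color t) R | t R. s = [] \<and> (R, map Const t) \<in> U} \<union>
     {Cnst (cs ! i) | i. s = rib i \<and> i < length cs} \<union>
     {Recol False (Origin k) (tuple_color (replicate k (cs ! i))) | i k.
        s = spine i \<and> i < length cs \<and> k \<in> {1..max_ar}} \<union>
     {Add (Origin k) (tuple_color b) I (tuple_color (interleave I (replicate k (cs ! i)) b)) | i k b I.
        s = spine i \<and> i < length cs \<and> 1 \<le> k \<and> set b \<subseteq> set cs \<and> b \<noteq> [] \<and>
        k + length b \<le> max_ar \<and> I \<subseteq> {1..k + length b} \<and> card I = k}"

lemma max_ar: "R \<in> \<Sigma> \<Longrightarrow> ar R \<le> max_ar"
  using sig unfolding max_ar_def signature_def by simp

lemma tree_simps:
  "Star \<in> tree s \<longleftrightarrow> False"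
  "Cnst c \<in> tree s \<longleftrightarrow> (\<exists>i<length cs. s = rib i \<and> c = cs ! i)"
  "RAdd \<kappa> \<mu> I R \<in> tree s \<longleftrightarrow> False"
  "Mat j \<kappa> R \<in> tree s \<longleftrightarrow> j \<and> s = [] \<and> (\<exists>t. \<kappa> = tuple_color t \<and> (R, map Const t) \<in> U)"
  "Recol j \<kappa> \<nu> \<in> tree s \<longleftrightarrow> \<not> j \<and> (\<exists>i k. s = spine i \<and> i < length cs \<and> k \<in> {1..max_ar} \<and>
     \<kappa> = Origin k \<and> \<nu> = tuple_color (replicate k (cs ! i)))"
  "Add \<kappa> \<mu> I \<nu> \<in> tree s \<longleftrightarrow> (\<exists>i k b. s = spine i \<and> i < length cs \<and> 1 \<le> k \<and> set b \<subseteq> set cs \<and>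
     b \<noteq> [] \<and> k + length b \<le> max_ar \<and> I \<subseteq> {1..k + length b} \<and> card I = k \<and> \<kappa> = Origin k \<and>
     \<mu> = tuple_color b \<and> \<nu> = tuple_color (interleave I (replicate k (cs ! i)) b))"
  unfolding tree_def by auto

lemma creates_tree: "creates tree s e \<longleftrightarrow> (\<exists>i<length cs. s = rib i \<and> e = Const (cs ! i))"
  unfolding creates_def tree_simps by blast

lemma pseudoleaf_tree: "pseudoleaf tree s \<longleftrightarrow> (\<exists>i<length cs. s = rib i)"
  unfolding pseudoleaf_def creates_tree by blast

lemma atom_U:
  assumes "(R, ts) \<in> U"
  obtains t where "ts = map Const t" "set t \<subseteq> set cs" "R \<in> \<Sigma>" "length t = ar R" "t \<noteq> []"
    "length t \<le> max_ar"
proof -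
  have "set ts \<subseteq> terms_of U" 
    using UN_upper[OF assms, of "\<lambda>a. set (snd a)"] unfolding terms_of_def by simp
  then have sub: "set ts \<subseteq> Const ` set cs" unfolding cs(2) .
  then have "set ts \<subseteq> range Const" by blast
  then obtain t where t: "ts = map Const t" using ground_list by blast
  have "atom_over \<Sigma> (R, ts)" using inst assms unfolding inst_over_def by blast
  then have R: "R \<in> \<Sigma>" "length ts = ar R" unfolding atom_over_def by simp_all
  moreover have "1 \<le> ar R" using R(1) sig unfolding signature_def by blast
  moreover have "set t \<subseteq> set cs" using sub t by auto
  ultimately show ?thesis using that[of t] t max_ar[OF R(1)] by (cases t) auto
qed

lemma tuple_U:
  assumes "(R, map Const t) \<in> U"
  shows "set t \<subseteq> set cs" "R \<in> \<Sigma>" "length t = ar R" "t \<noteq> []" "length t \<le> max_ar"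
proof -
  have "inj (Const :: nat \<Rightarrow> 'n gterm)" by (rule injI) simp
  then show "set t \<subseteq> set cs" "R \<in> \<Sigma>" "length t = ar R" "t \<noteq> []" "length t \<le> max_ar"
    using atom_U[OF assms] by (metis inj_map_eq_map)+
qed

lemma color_set_colors: "color_set \<Sigma> colors"
proof -
  have "finite {t. set t \<subseteq> set cs \<and> length t \<le> max_ar \<and> t \<noteq> []}"
    by (rule finite_subset[OF _ finite_lists_length_le[of "set cs" max_ar]]) auto
  then show ?thesis
    unfolding color_set_def colors_def max_ar_def[symmetric]
    by (auto simp: Suc_le_eq)
qed

lemma tree_decorator_over:
  assumes "d \<in> tree s"
  shows "decorator_over \<Sigma> colors d"
proof (cases d)
  case (Add \<kappa> \<mu> I \<nu>)
  with assms obtain i k b where *: "i < length cs" "1 \<le> k" "set b \<subseteq> set cs"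
     "b \<noteq> []" "k + length b \<le> max_ar" "I \<subseteq> {1..k + length b}" "card I = k" "\<kappa> = Origin k"
     "\<mu> = tuple_color b" "\<nu> = tuple_color (interleave I (replicate k (cs ! i)) b)"
    by (auto simp: tree_simps)
  from *(4,6,7) have I: "I \<subset> {1..k + length b}" by (rule proper_positions)
  let ?t = "interleave I (replicate k (cs ! i)) b"
  have "set ?t \<subseteq> set (replicate k (cs ! i)) \<union> set b"
    by (rule set_interleave) (use * I in simp_all)
  also have "\<dots> \<subseteq> set cs" using * by auto
  finally have t: "set ?t \<subseteq> set cs" "length ?t = k + length b" by (simp_all add: length_interleave)
  then have "?t \<noteq> []" using *(2) by auto
  then show ?thesis
    using * t I unfolding Add colors_def by (simp add: length_interleave)
next
  case (Mat j \<kappa> R)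
  with assms obtain t where t: "\<kappa> = tuple_color t" "(R, map Const t) \<in> U"
    by (auto simp: tree_simps)
  from tuple_U[OF t(2)] t(1) show ?thesis unfolding Mat colors_def by simp
qed (use assms in \<open>auto simp: tree_simps colors_def\<close>)

text \<open>Instructions are compatible because their target is a function of the node, the sources
  and \<open>I\<close>; distinctness of \<open>cs\<close> keeps each constant at one node.\<close>

lemma well_decorated_tree: "well_decorated \<Sigma> colors tree"
  unfolding well_decorated_def
proof (intro conjI allI impI)
  fix s d assume *: "d \<in> tree s \<and> (d = Star \<or> (\<exists>c. d = Cnst c))"
  then obtain i where i: "i < length cs" "s = rib i" "d = Cnst (cs ! i)" by (auto simp: tree_simps)
  then show "tree s = {d}" by (auto simp: tree_def)
  fix s' :: node assume "s' \<noteq> []"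
  then show "tree (s @ s') = {}"
    using rib_neq_spine[of i s'] rib_eq[of i s' _ "[]"] unfolding tree_def i(2) by auto
next
  fix c s s' assume "Cnst c \<in> tree s \<and> Cnst c \<in> tree s'"
  then show "s = s'" using cs(1) by (auto simp: tree_simps nth_eq_iff_index_eq)
qed (use tree_decorator_over in \<open>auto simp: tree_simps\<close>)

text \<open>Vertebrae and ribs share one induction, because instructions at a vertebra read from
  both. On the spine a color determines its tuple, so \<open>Mat\<close> at the root adds no atom
  outside \<open>U\<close>.\<close>

lemma has_col_tree_sound:
  assumes "has_col colors tree s \<nu> a"
  shows "s = spine i \<Longrightarrow> \<exists>t. a = map Const t \<and> \<nu> = tuple_color t"
    and "s = rib i \<Longrightarrow> i < length cs \<and> (\<exists>k\<in>{1..max_ar}. \<nu> = Origin k \<and> a = replicate k (Const (cs ! i)))"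
  using assms
proof (induction arbitrary: i rule: has_col.induct)
  case (leaf s e k)
  { case 1
    then show ?case using leaf by (auto simp: creates_tree)
  next
    case 2
    then show ?case using leaf by (auto simp: creates_tree colors_def) }
next
  case (add s \<kappa> \<mu> I \<nu> a b)
  from add.hyps(2) obtain i' k b' where *: "s = spine i'" "i' < length cs"
     "I \<subseteq> {1..k + length b'}" "card I = k" "\<kappa> = Origin k"
     "\<mu> = tuple_color b'" "\<nu> = tuple_color (interleave I (replicate k (cs ! i')) b')" "b' \<noteq> []"
    by (auto simp: tree_simps)
  from *(8,3,4) have I: "I \<subset> {1..k + length b'}" by (rule proper_positions)
  { case 1
    have "a = replicate k (Const (cs ! i'))" using add.IH(2)[of i'] * by simp
    then have a: "a = map Const (replicate k (cs ! i'))" by simp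
    have b: "b = map Const b'" using add.IH(3)[of "Suc i'"] * by auto
    have "interleave I a b = map Const (interleave I (replicate k (cs ! i')) b')"
      unfolding a b by (rule map_interleave[symmetric]) (use * I in simp_all)
    then show ?case using *(7) by blast
  next
    case 2
    then show ?case using *(1) by simp }
next
  case (recol s j \<kappa> \<nu> a)
  from recol.hyps(2) obtain i' k where *: "\<not> j" "s = spine i'" "\<kappa> = Origin k"
      "\<nu> = tuple_color (replicate k (cs ! i'))"
    by (auto simp: tree_simps)
  { case 1
    have "a = map Const (replicate k (cs ! i'))" using recol.IH(2)[of i'] * by simp
    then show ?case using *(4) by blast
  next
    case 2
    then show ?case using *(2) by simp }
next
  case (keep s j \<nu> a)
  { case 1
    show ?case
    proof (cases j)
      case True
      then show ?thesis using keep.IH(1)[of "Suc i"] 1 by simp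
    next
      \<comment> \<open>All \<open>Origin\<close> colors of a rib are recolored at its vertebra, so
        \<open>keep\<close> never passes them on.\<close>
      case False
      then have "\<exists>\<kappa>. Recol j \<nu> \<kappa> \<in> tree s"
        using keep.IH(2)[of i] 1 by (auto simp: tree_simps)
      with keep.hyps(2) show ?thesis by blast
    qed
  next
    case 2
    \<comment> \<open>A tuple from strictly below a rib would need a creator there, but only ribs
      create entities.\<close>
    from has_col_creates[OF keep.hyps(3)] obtain u i' where "rib i @ (j # u) = rib i' @ []"
      using 2 by (auto simp: creates_tree)
    then show ?case unfolding rib_eq by simp }
qed

text \<open>Induction from the last constant back to the first: the copies of \<open>cs ! i\<close>
  in \<open>t\<close> come from the rib, the other entries \<open>b\<close> from the next vertebra.
  There may be no copies (\<open>keep\<close>), only copies (\<open>recol\<close>) or a mixture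
  (\<open>add\<close>).\<close>

lemma has_col_tree_complete:
  assumes "set t \<subseteq> set (drop i cs)" "t \<noteq> []" "length t \<le> max_ar" "i \<le> length cs"
  shows "has_col colors tree (spine i) (tuple_color t) (map Const t)"
  using assms(4,1,2,3)
proof (induction i arbitrary: t rule: inc_induct)
  case base
  then show ?case by simp
next
  case (step i)
  define c where "c = cs ! i"
  define b where "b = filter (\<lambda>x. x \<noteq> c) t"
  define k where "k = length (filter (\<lambda>x. x = c) t)"
  have drop: "drop i cs = c # drop (Suc i) cs"
    using step.hyps by (simp add: Cons_nth_drop_Suc c_def)
  have not_leaf: "\<not> pseudoleaf tree (spine i)" by (simp add: pseudoleaf_tree)
  have a: "filter (\<lambda>x. x = c) t = replicate k c"
    using replicate_length_filter[of c t] unfolding k_def by (simp add: eq_commute[of c])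
  have len: "k + length b = length t"
    unfolding k_def b_def by (rule sum_length_filter_compl)
  have b: "set b \<subseteq> set (drop (Suc i) cs)" "set b \<subseteq> set cs" "length b \<le> max_ar"
    using step.prems drop set_drop_subset[of i cs] len unfolding b_def by auto
  have leaf: "has_col colors tree (rib i) (Origin k) (replicate k (Const c))" if "1 \<le> k"
    using that step.hyps step.prems(3) len
    by (intro has_col.leaf) (auto simp: creates_tree colors_def c_def)
  have IH: "has_col colors tree (spine (Suc i)) (tuple_color b) (map Const b)" if "b \<noteq> []"
    using step.IH[OF b(1) that b(3)] .
  show ?case
  proof (cases "k = 0")
    case True
    then have "c \<notin> set t" unfolding k_def by (auto simp: filter_empty_conv)
    then have "b = t" unfolding b_def by (auto intro: filter_True)
    with IH step.prems(2) show ?thesis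
      by (intro has_col.keep[OF not_leaf, of True]) (auto simp: tree_simps)
  next
    case k: False
    show ?thesis
    proof (cases "b = []")
      case True
      then have "\<forall>x\<in>set t. x = c" unfolding b_def by (auto simp: filter_empty_conv)
      then have t: "t = replicate k c" using a by (simp add: filter_True)
      have "has_col colors tree (spine i) (tuple_color t) (replicate k (Const c))"
      proof (rule has_col.recol[OF not_leaf])
        show "Recol False (Origin k) (tuple_color t) \<in> tree (spine i)"
          using k t step.hyps step.prems(3) len by (auto simp: tree_simps c_def)
      qed (use leaf k in simp)
      then show ?thesis by (simp add: t)
    next
      case False
      define I where "I = {j. t ! (j - 1) = c \<and> 1 \<le> j \<and> j \<le> length t}"
      have I: "interleave I (replicate k c) b = t" "card I = k"
        using interleave_filter[of "\<lambda>x. x = c" t] unfolding a b_def I_def by simp_all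
      have sub: "I \<subseteq> {1..k + length b}" unfolding len I_def by auto
      from False sub I(2) have psub: "I \<subset> {1..k + length b}" by (rule proper_positions)
      have "has_col colors tree (spine i) (tuple_color t)
          (interleave I (map Const (replicate k c)) (map Const b))"
      proof (rule has_col.add[OF not_leaf])
        show "Add (Origin k) (tuple_color b) I (tuple_color t) \<in> tree (spine i)"
          unfolding tree_simps
          by (rule exI[of _ i], rule exI[of _ k], rule exI[of _ b])
            (use k I sub False b(2) len step.hyps step.prems(3) in \<open>simp add: c_def\<close>)
      qed (use leaf k IH False in simp_all)
      moreover have "interleave I (map Const (replicate k c)) (map Const b) =
          (map Const (interleave I (replicate k c) b) :: node gterm list)"
        by (rule map_interleave[symmetric]) (use psub I(2) in simp_all)
      ultimately show ?thesis using I(1) by simp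
    qed
  qed
qed

text \<open>\<open>Mat\<close> at the root yields all atoms. The \<open>Top\<close> atoms of the
  pseudoleaves add nothing, since an instance contains \<open>Top\<close> for each of its
  terms.\<close>

lemma tree_instance_tree:
  "tree_instance colors tree = {(R, map Const t) | R t. (R, map Const t) \<in> U}" (is "_ = ?V")
proof
  have "atoms_at colors tree s \<subseteq> ?V" for s
  proof (cases "pseudoleaf tree s")
    case True
    then obtain i where i: "i < length cs" "s = rib i" by (auto simp: pseudoleaf_tree)
    have "Const (cs ! i) \<in> terms_of U" using i(1) cs(2) by simp
    then have "(Top, map Const [cs ! i]) \<in> U" using inst unfolding inst_over_def by simp
    then have "(Top, map Const [cs ! i]) \<in> ?V" by blast
    then show ?thesis using True i by (auto simp: atoms_at_def creates_tree)
  next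
    case False
    have "[] @ [True] = spine 0" by (simp add: spine_def)
    then show ?thesis
      using False by (fastforce simp: atoms_at_def tree_simps dest: has_col_tree_sound(1)[of _ _ _ 0])
  qed
  then show "tree_instance colors tree \<subseteq> ?V" unfolding tree_instance_def by blast
  show "?V \<subseteq> tree_instance colors tree"
  proof
    fix x assume "x \<in> ?V"
    then obtain R t where x: "x = (R, map Const t)" "(R, map Const t) \<in> U" by blast
    note t = tuple_U[OF x(2)]
    have "has_col colors tree (spine 0) (tuple_color t) (map Const t)"
      by (rule has_col_tree_complete) (use t in simp_all)
    moreover have "spine 0 = [] @ [True]" by (simp add: spine_def)
    moreover have "Mat True (tuple_color t) R \<in> tree []" using x(2) by (auto simp: tree_simps)
    moreover have "\<not> pseudoleaf tree []" by (simp add: pseudoleaf_tree)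
    ultimately have "x \<in> atoms_at colors tree []" unfolding atoms_at_def x(1) by auto
    then show "x \<in> tree_instance colors tree" unfolding tree_instance_def by blast
  qed
qed

lemma finite_partitionwidth: "finite_partitionwidth \<Sigma> U"
proof -
  \<comment> \<open>Only the type of nulls changes. \<open>U\<close> has no nulls, so their image is
    arbitrary.\<close>
  define f :: "'n gterm \<Rightarrow> node gterm" where
    "f t = (case t of Const c \<Rightarrow> Const c | Null _ \<Rightarrow> Null [])" for t
  have map_f: "map f (map Const t) = map Const t" for t by (simp add: f_def)
  have img: "map_atom f ` U = tree_instance colors tree"
  proof
    show "map_atom f ` U \<subseteq> tree_instance colors tree"
    proof
      fix x assume "x \<in> map_atom f ` U"
      then obtain R ts where x: "x = (R, map f ts)" "(R, ts) \<in> U" by (auto simp: map_atom_def)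
      then obtain t where "ts = map Const t" using atom_U by metis
      with x show "x \<in> tree_instance colors tree"
        unfolding tree_instance_tree by (auto simp: map_f simp del: map_map)
    qed
    show "tree_instance colors tree \<subseteq> map_atom f ` U"
      unfolding tree_instance_tree
      by (force simp: map_atom_def map_f simp del: map_map intro: rev_image_eqI)
  qed
  have "terms_of (map_atom f ` U) = f ` terms_of U"
    unfolding terms_of_def map_atom_def by auto
  then have "bij_betw f (terms_of U) (terms_of (tree_instance colors tree))"
    unfolding img[symmetric] bij_betw_def by (auto simp: cs(2) inj_on_def f_def)
  moreover have "\<forall>t \<in> terms_of U. \<forall>c. f t = Const c \<longleftrightarrow> t = Const c"
    by (auto simp: cs(2) f_def)
  ultimately have "isomorphic U (tree_instance colors tree)"
    unfolding isomorphic_def using img by blast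
  then show ?thesis
    unfolding finite_partitionwidth_def using color_set_colors well_decorated_tree by blast
qed

end

lemma finite_partitionwidth_ground:
  assumes "signature \<Sigma>" "inst_over \<Sigma> U" "finite U" "terms_of U \<subseteq> range Const"
  shows "finite_partitionwidth \<Sigma> U"
proof -
  have "finite (terms_of U)" using assms(3) unfolding terms_of_def by simp
  then obtain C where C: "terms_of U = Const ` C" "finite C"
    using finite_subset_image[OF _ assms(4)] by blast
  obtain cs where "distinct cs" "set cs = C" using finite_distinct_list[OF C(2)] by blast
  with C assms interpret ground_instance \<Sigma> U cs by unfold_locales auto
  show ?thesis by (rule finite_partitionwidth)
qed


section \<open>Evaluating recursive functions by rules\<close>

text \<open>The numbering supplies predicate indices: 0 to 4 are the auxiliary predicates, odd
  indices from 5 on serve values, and even ones from 6 on serve searches.\<close>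

instance recf :: countable
  by countable_datatype

definition edgeP :: pred where "edgeP = Pred 3 2"
definition haltP :: pred where "haltP = Pred 4 1"

text \<open>The atom \<open>eval_atom p (xs @ [y])\<close> states that \<open>p\<close> has value \<open>y\<close> on \<open>xs\<close>, and
  \<open>search_atom p (n # xs)\<close> that \<open>p\<close> has positive values on \<open>m # xs\<close> for all \<open>m < n\<close>.\<close>

definition eval_atom :: "recf \<Rightarrow> 't list \<Rightarrow> 't atom" where
  "eval_atom p ts = (Pred (5 + 2 * to_nat p) (length ts), ts)"

definition search_atom :: "recf \<Rightarrow> 't list \<Rightarrow> 't atom" where
  "search_atom p ts = (Pred (6 + 2 * to_nat p) (length ts), ts)"

definition vars :: "nat \<Rightarrow> rterm list" where
  "vars k = map RVar [0..<k]"

text \<open>Guards that bind head variables in the body; a variable missing there would be read as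
  existential.\<close>

definition tops :: "nat \<Rightarrow> rterm atom list" where
  "tops k = map (\<lambda>i. (Top, [RVar i])) [0..<k]"

text \<open>Except for \<open>Succ\<close>, the variables below \<open>k\<close> hold the parameters
  and those from \<open>k\<close> on further values. All head variables occur in the body, so no
  terms are created. In the second search rule for \<open>Mu\<close>, a value is known to be
  positive because it has a predecessor.\<close>

fun rules :: "recf \<Rightarrow> nat \<Rightarrow> rule list" where
  "rules Zero k = [(tops k @ [(zeroP, [RVar k])], [eval_atom Zero (vars k @ [RVar k])])]"
| "rules Succ k = [([(succP, [RVar 0, RVar 1])], [eval_atom Succ [RVar 0, RVar 1]])]"
| "rules (Proj i) k = (if i < k then [(tops k, [eval_atom (Proj i) (vars k @ [RVar i])])] else [])"
| "rules (Comp f gs) k = rules f (length gs) @ concat (map (\<lambda>g. rules g k) gs) @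
     [(tops k @ map (\<lambda>j. eval_atom (gs ! j) (vars k @ [RVar (k + j)])) [0..<length gs] @
         [eval_atom f (map (\<lambda>j. RVar (k + j)) [0..<length gs] @ [RVar (k + length gs)])],
       [eval_atom (Comp f gs) (vars k @ [RVar (k + length gs)])])]"
| "rules (PrimRec f g) 0 = []"
| "rules (PrimRec f g) (Suc k) = rules f k @ rules g (Suc (Suc k)) @
     [([(zeroP, [RVar k]), eval_atom f (vars k @ [RVar (k + 1)])],
       [eval_atom (PrimRec f g) (RVar k # vars k @ [RVar (k + 1)])]),
      ([(succP, [RVar k, RVar (k + 1)]),
        eval_atom (PrimRec f g) (RVar k # vars k @ [RVar (k + 2)]),
        eval_atom g (RVar k # RVar (k + 2) # vars k @ [RVar (k + 3)])],
       [eval_atom (PrimRec f g) (RVar (k + 1) # vars k @ [RVar (k + 3)])])]"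
| "rules (Mu f) k = rules f (Suc k) @
     [(tops k @ [(zeroP, [RVar k])], [search_atom f (RVar k # vars k)]),
      ([search_atom f (RVar k # vars k), eval_atom f (RVar k # vars k @ [RVar (k + 1)]),
        (succP, [RVar (k + 2), RVar (k + 1)]), (succP, [RVar k, RVar (k + 3)])],
       [search_atom f (RVar (k + 3) # vars k)]),
      ([search_atom f (RVar k # vars k), eval_atom f (RVar k # vars k @ [RVar (k + 1)]),
        (zeroP, [RVar (k + 1)])],
       [eval_atom (Mu f) (vars k @ [RVar k])])]"

lemma map_atom_simps[simp]:
  "map_atom h (P, ts) = (P, map h ts)"
  "map_atom h (eval_atom p ts) = eval_atom p (map h ts)"
  "map_atom h (search_atom p ts) = search_atom p (map h ts)"
  by (simp_all add: map_atom_def eval_atom_def search_atom_def)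

lemma snd_atom[simp]: "snd (eval_atom p ts) = ts" "snd (search_atom p ts) = ts"
  by (simp_all add: eval_atom_def search_atom_def)

lemma map_subst_vars[simp]: "map (subst h) (vars k) = map h [0..<k]"
  by (simp add: vars_def)

lemma RVar_in_vars[simp]: "RVar v \<in> set (vars k) \<longleftrightarrow> v < k"
  by (auto simp: vars_def)

lemma length_vars[simp]: "length (vars k) = k"
  by (simp add: vars_def)

lemma tops_in: "(\<forall>a\<in>set (tops k). map_atom (subst h) a \<in> I) \<longleftrightarrow> (\<forall>i<k. (Top, [h i]) \<in> I)"
  by (auto simp: tops_def)

lemma body_vars_iff[simp]: "v \<in> body_vars (b, c) \<longleftrightarrow> (\<exists>a\<in>set b. RVar v \<in> set (snd a))"
  by (simp add: body_vars_def)

lemma tops_vars: "(\<exists>a\<in>set (tops k). RVar v \<in> set (snd a)) \<longleftrightarrow> v < k"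
  by (auto simp: tops_def)

lemma sat_datalogD:
  assumes "sat_rule I (b, [a])" "\<And>v. RVar v \<in> set (snd a) \<Longrightarrow> v \<in> body_vars (b, [a])"
    and "\<forall>a'\<in>set b. map_atom (subst h) a' \<in> I"
  shows "map_atom (subst h) a \<in> I"
proof -
  obtain h' where h': "\<forall>v \<in> body_vars (b, [a]). h' v = h v" "map_atom (subst h') a \<in> I"
    using assms(1,3) unfolding sat_rule_def by auto
  have "subst h' t = subst h t" if t: "t \<in> set (snd a)" for t
  proof (cases t)
    case (RVar v)
    then show ?thesis using t assms(2)[of v] h'(1) by simp
  qed simp
  then have "map_atom (subst h') a = map_atom (subst h) a" by (simp add: map_atom_def)
  with h'(2) show ?thesis by simp
qed

lemma sat_datalogI:
  assumes "\<And>h. \<forall>a'\<in>set b. map_atom (subst h) a' \<in> I \<Longrightarrow> map_atom (subst h) a \<in> I"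
  shows "sat_rule I (b, [a])"
  using assms unfolding sat_rule_def by auto

text \<open>A relation, not a function: in an arbitrary model a number can have many representatives
  and a term can represent many numbers.\<close>

fun rep :: "'n gterm atom set \<Rightarrow> nat \<Rightarrow> 'n gterm \<Rightarrow> bool" where
  "rep I 0 e \<longleftrightarrow> (zeroP, [e]) \<in> I"
| "rep I (Suc n) e \<longleftrightarrow> (\<exists>e'. rep I n e' \<and> (succP, [e', e]) \<in> I)"

text \<open>Assignments are given below as \<open>(!) l\<close>, so that variable \<open>v\<close>
  takes entry \<open>v\<close> of \<open>l\<close> and \<open>vars\<close> picks out the
  parameters.\<close>

lemma map_nth_prefix[simp]: "map ((!) (es @ zs)) [0..<length es] = es"
  by (rule nth_equalityI) (simp_all add: nth_append)

locale number_model =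
  fixes I :: "'n gterm atom set"
  assumes top: "\<And>P ts t. (P, ts) \<in> I \<Longrightarrow> t \<in> set ts \<Longrightarrow> (Top, [t]) \<in> I"
    and zero_ex: "\<exists>z. (zeroP, [z]) \<in> I"
    and succ_ex: "\<And>t. (Top, [t]) \<in> I \<Longrightarrow> \<exists>t'. (succP, [t, t']) \<in> I"
begin

lemma rep_top: "rep I n e \<Longrightarrow> (Top, [e]) \<in> I"
  by (cases n) (auto intro: top)

lemma rep_ex: "\<exists>e. rep I n e"
proof (induction n)
  case (Suc n)
  then show ?case using rep_top succ_ex by fastforce
qed (simp add: zero_ex)

lemma reps_top: "list_all2 (rep I) xs es \<Longrightarrow> i < length es \<Longrightarrow> (Top, [es ! i]) \<in> I"
  using rep_top by (auto simp: list_all2_conv_all_nth)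

text \<open>Each clause of \<open>reval\<close> is mirrored by Datalog rules. The representatives
  \<open>es\<close> must be arbitrary, since the induction hypotheses hand over those of
  intermediate values. As rules are positive, further atoms in \<open>I\<close> do no harm.\<close>

lemma eval_complete:
  assumes "reval p xs y" "\<forall>r\<in>set (rules p (length xs)). sat_rule I r" "list_all2 (rep I) xs es"
  shows "\<exists>d. rep I y d \<and> eval_atom p (es @ [d]) \<in> I"
  using assms
proof (induction arbitrary: es rule: reval.induct)
  case (zero xs)
  have len: "length xs = length es" using zero.prems(2) by (rule list_all2_lengthD)
  obtain z where z: "(zeroP, [z]) \<in> I" using zero_ex by blast
  have "map_atom (subst ((!) (es @ [z]))) (eval_atom Zero (vars (length es) @ [RVar (length es)])) \<in> I"
  proof (rule sat_datalogD)
    show "sat_rule I (tops (length es) @ [(zeroP, [RVar (length es)])],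
      [eval_atom Zero (vars (length es) @ [RVar (length es)])])"
      using zero.prems(1) len by simp
  qed (use reps_top[OF zero.prems(2)] z in
      \<open>auto simp: ball_Un tops_in bex_Un tops_vars nth_append\<close>)
  with z show ?case by auto
next
  case (succ x)
  from succ.prems(2) obtain e where e: "es = [e]" "rep I x e" by (auto simp: list_all2_Cons1)
  obtain e' where e': "(succP, [e, e']) \<in> I" using succ_ex rep_top[OF e(2)] by blast
  have "map_atom (subst ((!) [e, e'])) (eval_atom Succ [RVar 0, RVar 1]) \<in> I"
  proof (rule sat_datalogD)
    show "sat_rule I ([(succP, [RVar 0, RVar 1])], [eval_atom Succ [RVar 0, RVar 1]])"
      using succ.prems(1) by simp
  qed (use e' in auto)
  with e e' show ?case by auto
next
  case (proj i xs)
  have len: "length xs = length es" using proj.prems(2) by (rule list_all2_lengthD)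
  have "map_atom (subst ((!) (es @ []))) (eval_atom (Proj i) (vars (length es) @ [RVar i])) \<in> I"
  proof (rule sat_datalogD)
    show "sat_rule I (tops (length es), [eval_atom (Proj i) (vars (length es) @ [RVar i])])"
      using proj.prems(1) proj.hyps len by simp
  qed (use reps_top[OF proj.prems(2)] proj.hyps len in \<open>auto simp: tops_in tops_vars\<close>)
  then have "eval_atom (Proj i) (es @ [es ! i]) \<in> I"
    using map_nth_prefix[of es "[]"] by simp
  moreover have "rep I (xs ! i) (es ! i)" using proj by (simp add: list_all2_conv_all_nth)
  ultimately show ?case by blast
next
  case (comp xs gs ys f z)
  let ?k = "length es" and ?m = "length gs"
  have len: "length xs = ?k" using comp.prems(2) by (rule list_all2_lengthD)
  have len': "length ys = ?m" using list_all2_lengthD[OF comp.IH(1)] by simp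
  have "\<exists>d. rep I (ys ! j) d \<and> eval_atom (gs ! j) (es @ [d]) \<in> I" if "j < ?m" for j
  proof -
    have "\<forall>r\<in>set (rules (gs ! j) (length xs)). sat_rule I r"
      using comp.prems(1) nth_mem[OF that] by auto
    then show ?thesis
      using comp.IH(1) comp.prems(2) that by (simp add: list_all2_conv_all_nth)
  qed
  then obtain d where d: "\<And>j. j < ?m \<Longrightarrow> rep I (ys ! j) (d j) \<and> eval_atom (gs ! j) (es @ [d j]) \<in> I"
    by metis
  define ds where "ds = map d [0..<?m]"
  have "list_all2 (rep I) ys ds"
    using d len' by (simp add: list_all2_conv_all_nth ds_def)
  then obtain e where e: "rep I z e" "eval_atom f (ds @ [e]) \<in> I"
    using comp.IH(2)[of ds] comp.prems(1) len' by auto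
  let ?h = "(!) (es @ ds @ [e])"
  have h: "?h (?k + j) = d j" if "j < ?m" for j using that by (simp add: ds_def nth_append)
  have h': "?h (?k + ?m) = e" by (simp add: ds_def nth_append)
  have ds': "map (\<lambda>j. ?h (?k + j)) [0..<?m] = ds"
    unfolding ds_def using h by (auto simp: ds_def)
  have "map_atom (subst ?h) (eval_atom (Comp f gs) (vars ?k @ [RVar (?k + ?m)])) \<in> I"
  proof (rule sat_datalogD)
    show "sat_rule I (tops ?k @ map (\<lambda>j. eval_atom (gs ! j) (vars ?k @ [RVar (?k + j)])) [0..<?m] @
         [eval_atom f (map (\<lambda>j. RVar (?k + j)) [0..<?m] @ [RVar (?k + ?m)])],
       [eval_atom (Comp f gs) (vars ?k @ [RVar (?k + ?m)])])"
      using comp.prems(1) len by simp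
    have "map (subst ?h) (map (\<lambda>j. RVar (?k + j)) [0..<?m]) = ds"
      using ds' by (simp add: comp_def)
    then show "\<forall>a\<in>set (tops ?k @ map (\<lambda>j. eval_atom (gs ! j) (vars ?k @ [RVar (?k + j)])) [0..<?m] @
         [eval_atom f (map (\<lambda>j. RVar (?k + j)) [0..<?m] @ [RVar (?k + ?m)])]). map_atom (subst ?h) a \<in> I"
      using reps_top[OF comp.prems(2)] d h h' e
      by (auto simp: ball_Un tops_in nth_append simp del: map_map)
  qed (auto simp: bex_Un tops_vars)
  with e(1) h' show ?case by auto
next
  case (prim0 f xs y g)
  from prim0.prems(2) obtain z es' where es: "es = z # es'" "(zeroP, [z]) \<in> I"
      "list_all2 (rep I) xs es'" by (auto simp: list_all2_Cons1)
  let ?k = "length es'"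
  have len: "length xs = ?k" using es(3) by (rule list_all2_lengthD)
  obtain d where d: "rep I y d" "eval_atom f (es' @ [d]) \<in> I"
    using prim0.IH[OF _ es(3)] prim0.prems(1) by auto
  have "map_atom (subst ((!) (es' @ [z, d])))
      (eval_atom (PrimRec f g) (RVar ?k # vars ?k @ [RVar (?k + 1)])) \<in> I"
  proof (rule sat_datalogD)
    show "sat_rule I ([(zeroP, [RVar ?k]), eval_atom f (vars ?k @ [RVar (?k + 1)])],
       [eval_atom (PrimRec f g) (RVar ?k # vars ?k @ [RVar (?k + 1)])])"
      using prim0.prems(1) len by simp
  qed (use es d in \<open>auto simp: nth_append\<close>)
  then have "eval_atom (PrimRec f g) (es @ [d]) \<in> I" using es(1) by (simp add: nth_append)
  with d(1) show ?case by blast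
next
  case (primS f g n xs r y)
  from primS.prems(2) obtain e' e es' where es: "es = e' # es'" "rep I n e" "(succP, [e, e']) \<in> I"
      "list_all2 (rep I) xs es'" by (auto simp: list_all2_Cons1)
  let ?k = "length es'"
  have len: "length xs = ?k" using es(4) by (rule list_all2_lengthD)
  obtain c where c: "rep I r c" "eval_atom (PrimRec f g) ((e # es') @ [c]) \<in> I"
    using primS.IH(1)[of "e # es'"] primS.prems(1) es by auto
  obtain d where d: "rep I y d" "eval_atom g ((e # c # es') @ [d]) \<in> I"
    using primS.IH(2)[of "e # c # es'"] primS.prems(1) es c(1) by auto
  have "map_atom (subst ((!) (es' @ [e, e', c, d])))
      (eval_atom (PrimRec f g) (RVar (?k + 1) # vars ?k @ [RVar (?k + 3)])) \<in> I"
  proof (rule sat_datalogD)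
    show "sat_rule I ([(succP, [RVar ?k, RVar (?k + 1)]),
        eval_atom (PrimRec f g) (RVar ?k # vars ?k @ [RVar (?k + 2)]),
        eval_atom g (RVar ?k # RVar (?k + 2) # vars ?k @ [RVar (?k + 3)])],
       [eval_atom (PrimRec f g) (RVar (?k + 1) # vars ?k @ [RVar (?k + 3)])])"
      using primS.prems(1) len by simp
  qed (use es c d in \<open>auto simp: nth_append\<close>)
  then have "eval_atom (PrimRec f g) (es @ [d]) \<in> I" using es(1) by (simp add: nth_append)
  with d(1) show ?case by blast
next
  case (mu f n xs)
  let ?k = "length es"
  have len: "length xs = ?k" using mu.prems(2) by (rule list_all2_lengthD)
  have rules_f: "\<forall>r\<in>set (rules f (Suc (length xs))). sat_rule I r" using mu.prems(1) by simp
  have search: "search_atom f (e # es) \<in> I" if "rep I m e" "m \<le> n" for m e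
    using that
  proof (induction m arbitrary: e)
    case 0
    have "map_atom (subst ((!) (es @ [e]))) (search_atom f (RVar ?k # vars ?k)) \<in> I"
    proof (rule sat_datalogD)
      show "sat_rule I (tops ?k @ [(zeroP, [RVar ?k])], [search_atom f (RVar ?k # vars ?k)])"
        using mu.prems(1) len by simp
    qed (use reps_top[OF mu.prems(2)] 0 in
        \<open>auto simp: ball_Un tops_in bex_Un tops_vars nth_append\<close>)
    then show ?case by (simp add: nth_append)
  next
    case (Suc m)
    then obtain e0 where e0: "rep I m e0" "(succP, [e0, e]) \<in> I" by auto
    have s: "search_atom f (e0 # es) \<in> I" using Suc e0 by simp
    have "m < n" using Suc.prems(2) by simp
    from mu.IH(2)[THEN spec, THEN mp, OF this] obtain y where y: "y > 0"
      "(\<forall>r\<in>set (rules f (length (m # xs))). sat_rule I r) \<longrightarrow>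
       (\<forall>es. list_all2 (rep I) (m # xs) es \<longrightarrow> (\<exists>d. rep I y d \<and> eval_atom f (es @ [d]) \<in> I))"
      by (elim exE conjE)
    have "list_all2 (rep I) (m # xs) (e0 # es)" using e0(1) mu.prems(2) by simp
    with y(2) rules_f obtain d where d: "rep I y d" "eval_atom f ((e0 # es) @ [d]) \<in> I"
      unfolding length_Cons by blast
    \<comment> \<open>A predecessor of \<open>d\<close> certifies that the value is positive, as the
      second search rule demands.\<close>
    obtain c where c: "(succP, [c, d]) \<in> I" using y(1) d(1) by (cases y) auto
    have "map_atom (subst ((!) (es @ [e0, d, c, e]))) (search_atom f (RVar (?k + 3) # vars ?k)) \<in> I"
    proof (rule sat_datalogD)
      show "sat_rule I ([search_atom f (RVar ?k # vars ?k),
          eval_atom f (RVar ?k # vars ?k @ [RVar (?k + 1)]),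
          (succP, [RVar (?k + 2), RVar (?k + 1)]), (succP, [RVar ?k, RVar (?k + 3)])],
         [search_atom f (RVar (?k + 3) # vars ?k)])"
        using mu.prems(1) len by simp
    qed (use s d c e0 in \<open>auto simp: nth_append\<close>)
    then show ?case by (simp add: nth_append)
  qed
  \<comment> \<open>The result \<open>n\<close> need not be among the arguments; its representative
    comes from the existence of successors.\<close>
  obtain e where e: "rep I n e" using rep_ex by blast
  obtain z where z: "rep I 0 z" "eval_atom f ((e # es) @ [z]) \<in> I"
    using mu.IH(1)[of "e # es"] rules_f e mu.prems(2) by auto
  have "map_atom (subst ((!) (es @ [e, z]))) (eval_atom (Mu f) (vars ?k @ [RVar ?k])) \<in> I"
  proof (rule sat_datalogD)
    show "sat_rule I ([search_atom f (RVar ?k # vars ?k),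
        eval_atom f (RVar ?k # vars ?k @ [RVar (?k + 1)]), (zeroP, [RVar (?k + 1)])],
       [eval_atom (Mu f) (vars ?k @ [RVar ?k])])"
      using mu.prems(1) len by simp
  qed (use search[OF e] z in \<open>auto simp: nth_append\<close>)
  with e show ?case by (auto simp: nth_append)
qed

end


section \<open>The standard model\<close>

fun num :: "nat \<Rightarrow> nat gterm" where
  "num 0 = Const 0"
| "num (Suc n) = Null n"

lemma num_eq[simp]: "num m = num n \<longleftrightarrow> m = n"
  by (cases m; cases n) auto

declare num.simps[simp del]

lemma map_num_eq[simp]: "map num xs = map num ys \<longleftrightarrow> xs = ys"
  by (rule inj_map_eq_map) (simp add: inj_def)

text \<open>The edges make \<open>prod_encode (x, w)\<close> the vertex that the edge rule demands
  for \<open>x\<close> and \<open>w\<close>, so no vertex has more than two predecessors. The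
  absence of \<open>haltP\<close> keeps the model from collapsing.\<close>

definition nat_model :: "nat \<Rightarrow> nat gterm atom set" where
  "nat_model b =
     {(Top, [num n]) | n. True} \<union> {(zeroP, [num 0])} \<union> {(inputP, [num b])} \<union>
     {(succP, [num n, num (Suc n)]) | n. True} \<union>
     {(edgeP, [num x, num z]) | x z. x = fst (prod_decode z) \<or> x = snd (prod_decode z)} \<union>
     {eval_atom p (map num (xs @ [y])) | p xs y. reval p xs y} \<union>
     {search_atom f (map num (n # xs)) | f n xs. \<forall>m<n. \<exists>y>0. reval f (m # xs) y}"

lemmas pred_defs = zeroP_def succP_def inputP_def edgeP_def haltP_def

lemma eval_neq_search: "5 + 2 * m \<noteq> 6 + 2 * (n :: nat)"
  by presburger

lemma nat_model_basic:
  "(Top, [t]) \<in> nat_model b \<longleftrightarrow> (\<exists>n. t = num n)"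
  "(zeroP, [t]) \<in> nat_model b \<longleftrightarrow> t = num 0"
  "(inputP, [t]) \<in> nat_model b \<longleftrightarrow> t = num b"
  "(haltP, [t]) \<notin> nat_model b"
  "(succP, [s, t]) \<in> nat_model b \<longleftrightarrow> (\<exists>n. s = num n \<and> t = num (Suc n))"
  "(edgeP, [s, t]) \<in> nat_model b \<longleftrightarrow>
     (\<exists>x z. s = num x \<and> t = num z \<and> (x = fst (prod_decode z) \<or> x = snd (prod_decode z)))"
  unfolding nat_model_def pred_defs eval_atom_def search_atom_def by auto

lemma nat_model_eval:
  "eval_atom p (ts @ [t]) \<in> nat_model b \<longleftrightarrow>
     (\<exists>xs y. ts = map num xs \<and> t = num y \<and> reval p xs y)"
proof -
  have "eval_atom p ts' \<in> nat_model b \<longleftrightarrow> (\<exists>xs y. ts' = map num (xs @ [y]) \<and> reval p xs y)" for ts'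
    using eval_neq_search[of "to_nat p"]
    unfolding nat_model_def pred_defs eval_atom_def search_atom_def by auto
  then show ?thesis by auto
qed

lemma nat_model_eval1:
  "eval_atom p (s # ts @ [t]) \<in> nat_model b \<longleftrightarrow>
     (\<exists>x xs y. s = num x \<and> ts = map num xs \<and> t = num y \<and> reval p (x # xs) y)"
  using nat_model_eval[of p "s # ts" t b] by (auto simp: Cons_eq_map_conv)

lemma nat_model_eval2:
  "eval_atom p (s # s' # ts @ [t]) \<in> nat_model b \<longleftrightarrow>
     (\<exists>x x' xs y. s = num x \<and> s' = num x' \<and> ts = map num xs \<and> t = num y \<and> reval p (x # x' # xs) y)"
  using nat_model_eval[of p "s # s' # ts" t b] by (auto simp: Cons_eq_map_conv)

lemma nat_model_search:
  "search_atom f (t # ts) \<in> nat_model b \<longleftrightarrow>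
     (\<exists>n xs. t = num n \<and> ts = map num xs \<and> (\<forall>m<n. \<exists>y>0. reval f (m # xs) y))"
  using eval_neq_search[of _ "to_nat f"] eval_neq_search[of _ "to_nat f", symmetric]
  unfolding nat_model_def pred_defs eval_atom_def search_atom_def by auto

lemmas nat_model_simps =
  nat_model_basic nat_model_eval nat_model_eval1 nat_model_eval2 nat_model_search

lemma tops_nat_model:
  assumes "\<forall>i<k. (Top, [h i]) \<in> nat_model b"
  obtains xs where "map h [0..<k] = map num xs" "length xs = k" "\<And>i. i < k \<Longrightarrow> h i = num (xs ! i)"
proof -
  from assms obtain g where g: "\<And>i. i < k \<Longrightarrow> h i = num (g i)"
    unfolding nat_model_basic by metis
  show ?thesis by (rule that[of "map g [0..<k]"]) (use g in auto)
qed

text \<open>Each rule becomes an introduction rule of \<open>reval\<close>, or starts a search or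
  extends it by one argument.\<close>

lemma nat_model_sat_rules: "r \<in> set (rules p k) \<Longrightarrow> sat_rule (nat_model b) r"
proof (induction p k rule: rules.induct)
  case (1 k)
  then have r: "r = (tops k @ [(zeroP, [RVar k])], [eval_atom Zero (vars k @ [RVar k])])" by simp
  show ?case unfolding r
  proof (rule sat_datalogI)
    fix h assume "\<forall>a\<in>set (tops k @ [(zeroP, [RVar k])]). map_atom (subst h) a \<in> nat_model b"
    then have *: "\<forall>i<k. (Top, [h i]) \<in> nat_model b" "(zeroP, [h k]) \<in> nat_model b"
      by (auto simp: ball_Un tops_in)
    from *(1) obtain xs where "map h [0..<k] = map num xs" by (rule tops_nat_model)
    with *(2) show "map_atom (subst h) (eval_atom Zero (vars k @ [RVar k])) \<in> nat_model b"
      by (auto simp: nat_model_simps intro: reval.zero)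
  qed
next
  case (2 k)
  then have r: "r = ([(succP, [RVar 0, RVar 1])], [eval_atom Succ [RVar 0, RVar 1]])" by simp
  show ?case unfolding r
    by (rule sat_datalogI)
      (use nat_model_eval1[of Succ _ "[]"] in \<open>auto simp: nat_model_basic intro: reval.succ\<close>)
next
  case (3 i k)
  then have i: "i < k" and r: "r = (tops k, [eval_atom (Proj i) (vars k @ [RVar i])])"
    by (auto split: if_splits)
  show ?case unfolding r
  proof (rule sat_datalogI)
    fix h assume "\<forall>a\<in>set (tops k). map_atom (subst h) a \<in> nat_model b"
    then have "\<forall>i<k. (Top, [h i]) \<in> nat_model b" by (simp add: tops_in)
    then obtain xs where "map h [0..<k] = map num xs" "length xs = k" "h i = num (xs ! i)"
      using i by (metis tops_nat_model)
    with i show "map_atom (subst h) (eval_atom (Proj i) (vars k @ [RVar i])) \<in> nat_model b"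
      by (auto simp: nat_model_simps intro: reval.proj)
  qed
next
  case (4 f gs k)
  let ?m = "length gs"
  let ?b = "tops k @ map (\<lambda>j. eval_atom (gs ! j) (vars k @ [RVar (k + j)])) [0..<?m] @
         [eval_atom f (map (\<lambda>j. RVar (k + j)) [0..<?m] @ [RVar (k + ?m)])]"
  let ?a = "eval_atom (Comp f gs) (vars k @ [RVar (k + ?m)])"
  from "4.prems" consider "r \<in> set (rules f ?m)" | g where "g \<in> set gs" "r \<in> set (rules g k)"
    | "r = (?b, [?a])" by auto
  then show ?case
  proof cases
    case 1
    then show ?thesis by (rule "4.IH"(1))
  next
    case (2 g)
    then show ?thesis by (rule "4.IH"(2))
  next
    case 3
    show ?thesis unfolding 3
    proof (rule sat_datalogI)
      fix h assume "\<forall>a\<in>set ?b. map_atom (subst h) a \<in> nat_model b"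
      then have *: "\<forall>i<k. (Top, [h i]) \<in> nat_model b"
        "\<And>j. j < ?m \<Longrightarrow> eval_atom (gs ! j) (map h [0..<k] @ [h (k + j)]) \<in> nat_model b"
        "eval_atom f (map (\<lambda>j. h (k + j)) [0..<?m] @ [h (k + ?m)]) \<in> nat_model b"
        by (simp_all add: ball_Un tops_in comp_def)
      from *(1) obtain xs where xs: "map h [0..<k] = map num xs" by (rule tops_nat_model)
      from *(3) obtain ys z where ys: "map (\<lambda>j. h (k + j)) [0..<?m] = map num ys"
          "h (k + ?m) = num z" "reval f ys z"
        by (auto simp: nat_model_eval)
      have len: "length ys = ?m" using arg_cong[OF ys(1), of length] by simp
      have "reval (gs ! j) xs (ys ! j)" if "j < ?m" for j
      proof -
        have "h (k + j) = num (ys ! j)"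
          using arg_cong[OF ys(1), of "\<lambda>l. l ! j"] that len by simp
        with *(2)[OF that] xs show ?thesis by (auto simp: nat_model_eval)
      qed
      then have "list_all2 (\<lambda>g y. reval g xs y) gs ys"
        using len by (simp add: list_all2_conv_all_nth)
      then have "reval (Comp f gs) xs z" using ys(3) by (rule reval.comp)
      with xs ys(2) show "map_atom (subst h) ?a \<in> nat_model b"
        by (auto simp: nat_model_eval)
    qed
  qed
next
  case (5 f g)
  then show ?case by simp
next
  case (6 f g k)
  let ?r1 = "([(zeroP, [RVar k]), eval_atom f (vars k @ [RVar (k + 1)])],
       [eval_atom (PrimRec f g) (RVar k # vars k @ [RVar (k + 1)])])"
  let ?r2 = "([(succP, [RVar k, RVar (k + 1)]),
        eval_atom (PrimRec f g) (RVar k # vars k @ [RVar (k + 2)]),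
        eval_atom g (RVar k # RVar (k + 2) # vars k @ [RVar (k + 3)])],
       [eval_atom (PrimRec f g) (RVar (k + 1) # vars k @ [RVar (k + 3)])])"
  from "6.prems" consider "r \<in> set (rules f k)" | "r \<in> set (rules g (Suc (Suc k)))"
    | "r = ?r1" | "r = ?r2" by auto
  then show ?case
  proof cases
    case 1
    then show ?thesis by (rule "6.IH"(1))
  next
    case 2
    then show ?thesis by (rule "6.IH"(2))
  next
    case 3
    show ?thesis unfolding 3
      by (rule sat_datalogI) (auto simp: nat_model_simps intro: reval.prim0)
  next
    case 4
    show ?thesis unfolding 4
      by (rule sat_datalogI) (auto simp: nat_model_simps intro: reval.primS)
  qed
next
  case (7 f k)
  let ?r1 = "(tops k @ [(zeroP, [RVar k])], [search_atom f (RVar k # vars k)])"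
  let ?r2 = "([search_atom f (RVar k # vars k), eval_atom f (RVar k # vars k @ [RVar (k + 1)]),
        (succP, [RVar (k + 2), RVar (k + 1)]), (succP, [RVar k, RVar (k + 3)])],
       [search_atom f (RVar (k + 3) # vars k)])"
  let ?r3 = "([search_atom f (RVar k # vars k), eval_atom f (RVar k # vars k @ [RVar (k + 1)]),
        (zeroP, [RVar (k + 1)])],
       [eval_atom (Mu f) (vars k @ [RVar k])])"
  from "7.prems" consider "r \<in> set (rules f (Suc k))" | "r = ?r1" | "r = ?r2" | "r = ?r3" by auto
  then show ?case
  proof cases
    case 1
    then show ?thesis by (rule "7.IH")
  next
    case 2
    show ?thesis unfolding 2
    proof (rule sat_datalogI)
      fix h assume "\<forall>a\<in>set (tops k @ [(zeroP, [RVar k])]). map_atom (subst h) a \<in> nat_model b"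
      then have *: "\<forall>i<k. (Top, [h i]) \<in> nat_model b" "(zeroP, [h k]) \<in> nat_model b"
        by (auto simp: ball_Un tops_in)
      from *(1) obtain xs where "map h [0..<k] = map num xs" by (rule tops_nat_model)
      with *(2) show "map_atom (subst h) (search_atom f (RVar k # vars k)) \<in> nat_model b"
        by (auto simp: nat_model_simps)
    qed
  next
    case 3
    show ?thesis unfolding 3
      by (rule sat_datalogI) (auto simp: nat_model_simps less_Suc_eq)
  next
    case 4
    show ?thesis unfolding 4
      by (rule sat_datalogI) (auto simp: nat_model_simps intro: reval.mu)
  qed
qed


section \<open>The reduction\<close>

text \<open>Since rules mention no constant but 0, the constants of a database and
  \<open>Const 0\<close> suffice for a finite model; nonempty argument lists give positive
  arities.\<close>

definition wf_atom :: "rterm atom \<Rightarrow> bool" where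
  "wf_atom a \<longleftrightarrow> length (snd a) = ar (fst a) \<and> snd a \<noteq> [] \<and> (\<forall>c. RConst c \<in> set (snd a) \<longrightarrow> c = 0)"

definition wf_rule :: "rule \<Rightarrow> bool" where
  "wf_rule r \<longleftrightarrow> (\<forall>a \<in> set (fst r) \<union> set (snd r). wf_atom a)"

lemma RConst_in_vars[simp]: "RConst c \<notin> set (vars k)"
  by (auto simp: vars_def)

lemma wf_atom_simps[simp]:
  "wf_atom (eval_atom p ts) \<longleftrightarrow> ts \<noteq> [] \<and> (\<forall>c. RConst c \<in> set ts \<longrightarrow> c = 0)"
  "wf_atom (search_atom p ts) \<longleftrightarrow> ts \<noteq> [] \<and> (\<forall>c. RConst c \<in> set ts \<longrightarrow> c = 0)"
  "wf_atom (P, ts) \<longleftrightarrow> length ts = ar P \<and> ts \<noteq> [] \<and> (\<forall>c. RConst c \<in> set ts \<longrightarrow> c = 0)"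
  by (simp_all add: wf_atom_def eval_atom_def search_atom_def)

lemma wf_tops[simp]: "\<forall>a\<in>set (tops k). wf_atom a"
  by (auto simp: tops_def)

lemma wf_rule_simps[simp]:
  "wf_rule (b, c) \<longleftrightarrow> (\<forall>a\<in>set b. wf_atom a) \<and> (\<forall>a\<in>set c. wf_atom a)"
  by (auto simp: wf_rule_def)

lemma ar_preds[simp]: "ar zeroP = 1" "ar succP = 2" "ar inputP = 1" "ar edgeP = 2" "ar haltP = 1"
  by (simp_all add: pred_defs)

lemma wf_rules: "r \<in> set (rules p k) \<Longrightarrow> wf_rule r"
  by (induction p k rule: rules.induct)
    (auto simp: ball_Un split: if_splits)

definition base_rules :: "recf \<Rightarrow> rule list" where
  "base_rules q =
     [([], [(zeroP, [RConst 0])]),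
      ([(Top, [RVar 0])], [(succP, [RVar 0, RVar 1])]),
      ([(Top, [RVar 0]), (Top, [RVar 1])], [(edgeP, [RVar 0, RVar 2]), (edgeP, [RVar 1, RVar 2])]),
      ([(inputP, [RVar 0]), eval_atom q [RVar 0, RVar 1], (zeroP, [RVar 1])], [(haltP, [RVar 0])])] @
     rules q 1"

text \<open>Read off from the base rules alone, which avoids circularity with the collapse rules;
  these and the input rule use no other predicates.\<close>

definition preds :: "recf \<Rightarrow> pred list" where
  "preds q = Top # concat (map (\<lambda>r. map fst (fst r @ snd r)) (base_rules q))"

text \<open>The halting term gets the variable \<open>ar P\<close>, the first one not taken by the
  arguments.\<close>

definition collapse_rule :: "pred \<Rightarrow> rule" where
  "collapse_rule P = ((haltP, [RVar (ar P)]) # tops (ar P), [(P, vars (ar P))])"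

definition program :: "recf \<Rightarrow> rule list" where
  "program q = base_rules q @ map collapse_rule (preds q)"

lemma wf_base_rules: "r \<in> set (base_rules q) \<Longrightarrow> wf_rule r"
  unfolding base_rules_def by (auto simp: wf_rules)

lemma preds_base: "r \<in> set (base_rules q) \<Longrightarrow> a \<in> set (fst r) \<union> set (snd r) \<Longrightarrow> fst a \<in> set (preds q)"
  unfolding preds_def by force

lemma preds_ar: "P \<in> set (preds q) \<Longrightarrow> 1 \<le> ar P"
proof -
  assume "P \<in> set (preds q)"
  then consider "P = Top" | r a where "r \<in> set (base_rules q)" "a \<in> set (fst r) \<union> set (snd r)" "P = fst a"
    unfolding preds_def by auto
  then show "1 \<le> ar P"
  proof cases
    case 2
    then have "wf_atom a" using wf_base_rules unfolding wf_rule_def by blast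
    then have "snd a \<noteq> []" "length (snd a) = ar P" using 2(3) by (auto simp: wf_atom_def)
    then show ?thesis by (cases "snd a") auto
  qed simp
qed

lemma preds_special: "{Top, zeroP, succP, inputP, edgeP, haltP} \<subseteq> set (preds q)"
  by (auto simp: preds_def base_rules_def)

lemma path_atoms: "a \<in> set (path n) \<Longrightarrow> wf_atom a \<and> fst a \<in> {zeroP, succP}"
  by (induction n) auto

lemma program_atoms:
  assumes "r \<in> set (input_rule n # program q)" "a \<in> set (fst r) \<union> set (snd r)"
  shows "wf_atom a" "fst a \<in> set (preds q)"
proof -
  from assms consider "r = input_rule n" | "r \<in> set (base_rules q)"
    | P where "P \<in> set (preds q)" "r = collapse_rule P"
    unfolding program_def by auto
  then have "wf_atom a \<and> fst a \<in> set (preds q)"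
  proof cases
    case 1
    then show ?thesis
      using assms(2) path_atoms[of a n] preds_special[of q] by (auto simp: input_rule_def)
  next
    case 2
    then show ?thesis using assms(2) wf_base_rules preds_base unfolding wf_rule_def by blast
  next
    case 3
    then show ?thesis
      using assms(2) preds_ar[OF 3(1)] preds_special[of q]
      by (auto simp: collapse_rule_def tops_def vars_def)
  qed
  then show "wf_atom a" "fst a \<in> set (preds q)" by auto
qed

lemma program_signature:
  "signature (set (preds q))" "ruleset_over (set (preds q)) (set (input_rule n # program q))"
proof -
  show "signature (set (preds q))"
    using preds_ar preds_special[of q] unfolding signature_def by auto
  show "ruleset_over (set (preds q)) (set (input_rule n # program q))"
    using program_atoms[of _ n q] unfolding ruleset_over_def rule_over_def atom_over_def wf_atom_def
    by blast
qed

lemma inst_over_top: "inst_over \<Sigma> I \<Longrightarrow> (P, ts) \<in> I \<Longrightarrow> t \<in> set ts \<Longrightarrow> (Top, [t]) \<in> I"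
  unfolding inst_over_def terms_of_def by force

lemma path_rep: "\<forall>a\<in>set (path n). map_atom (subst h) a \<in> I \<Longrightarrow> rep I n (h n)"
  by (induction n) auto

locale program_model =
  fixes \<Sigma> and D I :: "'n gterm atom set" and q n
  assumes model: "is_model \<Sigma> D (set (input_rule n # program q)) I"
begin

lemma sat: "r \<in> set (input_rule n # program q) \<Longrightarrow> sat_rule I r"
  using model unfolding is_model_def by blast

lemma sat_base: "r \<in> set (base_rules q) \<Longrightarrow> sat_rule I r"
  using sat unfolding program_def by simp

lemma top_I: "(P, ts) \<in> I \<Longrightarrow> t \<in> set ts \<Longrightarrow> (Top, [t]) \<in> I"
  using model inst_over_top unfolding is_model_def by blast

lemma zero_I: "(zeroP, [Const 0]) \<in> I"
proof -
  have "sat_rule I ([], [(zeroP, [RConst 0])])" by (rule sat_base) (simp add: base_rules_def)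
  then show ?thesis unfolding sat_rule_def by simp
qed

sublocale number_model I
proof
  show "\<exists>z. (zeroP, [z]) \<in> I" using zero_I by blast
  fix t assume t: "(Top, [t]) \<in> I"
  have "sat_rule I ([(Top, [RVar 0])], [(succP, [RVar 0, RVar 1])])"
    by (rule sat_base) (simp add: base_rules_def)
  with t obtain h :: "nat \<Rightarrow> 'n gterm" where "h 0 = t" "(succP, [h 0, h 1]) \<in> I"
    unfolding sat_rule_def by (auto simp: body_vars_def dest!: spec[of _ "\<lambda>_. t"])
  then show "\<exists>t'. (succP, [t, t']) \<in> I" by auto
qed (rule top_I)

lemma edge_ex:
  assumes "(Top, [x]) \<in> I" "(Top, [w]) \<in> I"
  shows "\<exists>z. (edgeP, [x, z]) \<in> I \<and> (edgeP, [w, z]) \<in> I"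
proof -
  have "sat_rule I ([(Top, [RVar 0]), (Top, [RVar 1])],
      [(edgeP, [RVar 0, RVar 2]), (edgeP, [RVar 1, RVar 2])])"
    by (rule sat_base) (simp add: base_rules_def)
  with assms obtain h :: "nat \<Rightarrow> 'n gterm" where "(edgeP, [x, h 2]) \<in> I" "(edgeP, [w, h 2]) \<in> I"
    unfolding sat_rule_def by (auto simp: body_vars_def dest!: spec[of _ "(!) [x, w]"])
  then show ?thesis by auto
qed

lemma halt:
  assumes "reval q [n] 0"
  shows "\<exists>x. (haltP, [x]) \<in> I"
proof -
  have "sat_rule I (input_rule n)" by (rule sat) simp
  then obtain h where h: "(inputP, [h n]) \<in> I" "\<forall>a\<in>set (path n). map_atom (subst h) a \<in> I"
    unfolding sat_rule_def input_rule_def by auto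
  have "list_all2 (rep I) [n] [h n]" using path_rep[OF h(2)] by simp
  moreover have "\<forall>r\<in>set (rules q (length [n])). sat_rule I r"
    using sat_base by (simp add: base_rules_def)
  ultimately have "\<exists>d. rep I 0 d \<and> eval_atom q ([h n] @ [d]) \<in> I"
    by (rule eval_complete[OF assms, rotated])
  then obtain d where d: "rep I 0 d" "eval_atom q [h n, d] \<in> I" by auto
  have "map_atom (subst ((!) [h n, d])) (haltP, [RVar 0]) \<in> I"
  proof (rule sat_datalogD)
    show "sat_rule I ([(inputP, [RVar 0]), eval_atom q [RVar 0, RVar 1], (zeroP, [RVar 1])],
        [(haltP, [RVar 0])])"
      by (rule sat_base) (simp add: base_rules_def)
  qed (use h(1) d in auto)
  then show ?thesis by auto
qed

lemma collapse:
  assumes "reval q [n] 0" "P \<in> set (preds q)" "length ts = ar P" "\<And>t. t \<in> set ts \<Longrightarrow> (Top, [t]) \<in> I"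
  shows "(P, ts) \<in> I"
proof -
  obtain x where x: "(haltP, [x]) \<in> I" using halt[OF assms(1)] by blast
  have "map_atom (subst ((!) (ts @ [x]))) (P, vars (ar P)) \<in> I"
  proof (rule sat_datalogD)
    show "sat_rule I ((haltP, [RVar (ar P)]) # tops (ar P), [(P, vars (ar P))])"
      using sat[of "collapse_rule P"] assms(2) by (auto simp: program_def collapse_rule_def)
  qed (use x assms(3,4) in \<open>auto simp: tops_in tops_vars nth_append\<close>)
  then show ?thesis using assms(3)[symmetric] by simp
qed

end

text \<open>The model consists of \<open>D\<close> and all \<open>preds q\<close> atoms over its
  constants and \<open>Const 0\<close>. By \<open>collapse\<close> it lies in every model, so the
  identity is a homomorphism. Atoms of \<open>D\<close> with predicates beyond
  \<open>preds q\<close> are kept as they are.\<close>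

lemma halting_finite_partitionwidth_set:
  assumes halts: "reval q [n] 0"
  shows "finite_partitionwidth_set (set (input_rule n # program q))"
  unfolding finite_partitionwidth_set_def
proof (intro allI impI)
  let ?R = "set (input_rule n # program q)"
  fix \<Sigma> and D :: "nat gterm atom set"
  assume "signature \<Sigma> \<and> ruleset_over \<Sigma> ?R" and D: "database \<Sigma> D"
  then have sig: "signature \<Sigma>" and over: "ruleset_over \<Sigma> ?R" by auto
  define C where "C = insert (Const 0) (terms_of D)"
  define U where "U = D \<union> {(P, ts). P \<in> set (preds q) \<and> set ts \<subseteq> C \<and> length ts = ar P}"
  have finC: "finite C" using D unfolding C_def database_def terms_of_def by simp
  have C: "C \<subseteq> range Const" using D unfolding C_def database_def by auto
  have U_eq: "U = D \<union> (\<Union>P\<in>set (preds q). Pair P ` {ts. set ts \<subseteq> C \<and> length ts = ar P})"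
    unfolding U_def by auto
  have finU: "finite U"
    using D finC unfolding U_eq database_def by (auto intro: finite_lists_length_eq)
  have terms: "terms_of U \<subseteq> C" unfolding U_def C_def terms_of_def by auto
  have Top: "Top \<in> set (preds q)" using preds_special by blast
  \<comment> \<open>Every predicate of \<open>preds q\<close> occurs in its collapse rule, hence in
    any signature of the ruleset.\<close>
  have preds: "set (preds q) \<subseteq> \<Sigma>"
  proof
    fix P assume "P \<in> set (preds q)"
    then have "collapse_rule P \<in> ?R" by (auto simp: program_def)
    then show "P \<in> \<Sigma>"
      using over unfolding ruleset_over_def rule_over_def atom_over_def collapse_rule_def by fastforce
  qed
  have inst: "inst_over \<Sigma> U"
    unfolding inst_over_def
  proof (intro conjI ballI)
    show "atom_over \<Sigma> a" if "a \<in> U" for a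
      using that D preds unfolding U_def database_def atom_over_def by auto
    show "(Top, [t]) \<in> U" if "t \<in> terms_of U" for t
      using that terms Top unfolding U_def by auto
  qed
  have sat: "sat_rule U r" if r: "r \<in> ?R" for r
    unfolding sat_rule_def
  proof (intro allI impI)
    fix h assume h: "\<forall>a\<in>set (fst r). map_atom (subst h) a \<in> U"
    \<comment> \<open>Existential variables may take any value in \<open>C\<close>, as all
      \<open>preds q\<close> atoms over \<open>C\<close> are present; \<open>Const 0\<close> is
      always there.\<close>
    define h' where "h' v = (if v \<in> body_vars r then h v else Const 0)" for v
    have "h v \<in> C" if v: "v \<in> body_vars r" for v
    proof -
      from v obtain a where a: "a \<in> set (fst r)" "RVar v \<in> set (snd a)"
        unfolding body_vars_def by blast
      have "subst h (RVar v) \<in> set (snd (map_atom (subst h) a))"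
        using a(2) unfolding map_atom_def snd_conv set_map by (rule imageI)
      then have "h v \<in> terms_of U" using h a(1) unfolding terms_of_def by auto
      then show ?thesis using terms by blast
    qed
    then have h': "h' v \<in> C" for v by (simp add: h'_def C_def)
    have "map_atom (subst h') a \<in> U" if a: "a \<in> set (snd r)" for a
    proof -
      have wf: "wf_atom a" "fst a \<in> set (preds q)" using program_atoms[OF r] a by auto
      have "subst h' t \<in> C" if "t \<in> set (snd a)" for t
      proof (cases t)
        case (RConst c)
        then show ?thesis using wf(1) that unfolding wf_atom_def by (auto simp: C_def)
      qed (simp add: h')
      then show ?thesis using wf unfolding U_def map_atom_def wf_atom_def by auto
    qed
    then show "\<exists>h'. (\<forall>v\<in>body_vars r. h' v = h v) \<and> (\<forall>a\<in>set (snd r). map_atom (subst h') a \<in> U)"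
      by (intro exI[of _ h']) (simp add: h'_def)
  qed
  have "is_model \<Sigma> D ?R U"
    unfolding is_model_def using inst sat by (auto simp: U_def)
  moreover have "\<exists>h. homomorphism h U I" if I: "is_model \<Sigma> D ?R I" for I :: "nat gterm atom set"
  proof -
    interpret program_model \<Sigma> D I q n by unfold_locales (rule I)
    have "D \<subseteq> I" using I unfolding is_model_def by blast
    have topC: "(Top, [t]) \<in> I" if "t \<in> C" for t
    proof (cases "t = Const 0")
      case True
      then show ?thesis using top_I[OF zero_I] by simp
    next
      case False
      with that obtain P ts where "(P, ts) \<in> D" "t \<in> set ts"
        unfolding C_def terms_of_def by auto
      then show ?thesis using top_I \<open>D \<subseteq> I\<close> by blast
    qed
    have "U \<subseteq> I"
      using \<open>D \<subseteq> I\<close> collapse[OF halts] topC unfolding U_def by blast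
    then have "homomorphism (\<lambda>t. t) U I" unfolding homomorphism_def map_atom_def by auto
    then show ?thesis by blast
  qed
  ultimately have "universal_model \<Sigma> D ?R U" unfolding universal_model_def by blast
  moreover have "finite_partitionwidth \<Sigma> U"
    using finite_partitionwidth_ground[OF sig inst finU] terms C by blast
  ultimately show "\<exists>U. universal_model \<Sigma> D ?R U \<and> finite_partitionwidth \<Sigma> U" by blast
qed

lemma nat_model_arity: "a \<in> nat_model b \<Longrightarrow> length (snd a) = ar (fst a)"
  unfolding nat_model_def eval_atom_def search_atom_def by auto

lemma nat_model_terms: "t \<in> terms_of (nat_model b) \<Longrightarrow> (Top, [t]) \<in> nat_model b"
  unfolding nat_model_basic
  unfolding terms_of_def nat_model_def eval_atom_def search_atom_def by auto

lemma nat_model_path: "a \<in> set (path n) \<Longrightarrow> map_atom (subst num) a \<in> nat_model b"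
  by (induction n) (auto simp: nat_model_basic)

lemma nat_model_sat_program:
  assumes not_halts: "\<not> reval q [n] 0" and r: "r \<in> set (input_rule n # program q)"
  shows "sat_rule (nat_model n) r"
proof -
  from r consider "r = input_rule n" | "r = ([], [(zeroP, [RConst 0])])"
    | "r = ([(Top, [RVar 0])], [(succP, [RVar 0, RVar 1])])"
    | "r = ([(Top, [RVar 0]), (Top, [RVar 1])], [(edgeP, [RVar 0, RVar 2]), (edgeP, [RVar 1, RVar 2])])"
    | "r = ([(inputP, [RVar 0]), eval_atom q [RVar 0, RVar 1], (zeroP, [RVar 1])], [(haltP, [RVar 0])])"
    | "r \<in> set (rules q 1)" | P where "r = collapse_rule P"
    unfolding program_def base_rules_def by auto
  then show ?thesis
  proof cases
    case 1
    show ?thesis unfolding 1 sat_rule_def input_rule_def body_vars_def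
      using nat_model_path by (auto simp: nat_model_basic intro!: exI[of _ num])
  next
    case 2
    show ?thesis unfolding 2 sat_rule_def by (auto simp: nat_model_basic num.simps body_vars_def)
  next
    case 3
    show ?thesis unfolding 3 sat_rule_def
    proof (intro allI impI)
      fix h assume "\<forall>a\<in>set (fst ([(Top, [RVar 0])], [(succP, [RVar 0, RVar 1])])).
        map_atom (subst h) a \<in> nat_model n"
      then obtain x where "h 0 = num x" by (auto simp: nat_model_basic)
      then show "\<exists>h'. (\<forall>v\<in>body_vars ([(Top, [RVar 0])], [(succP, [RVar 0, RVar 1])]). h' v = h v) \<and>
        (\<forall>a\<in>set (snd ([(Top, [RVar 0])], [(succP, [RVar 0, RVar 1])])). map_atom (subst h') a \<in> nat_model n)"
        by (intro exI[of _ "h(1 := num (Suc x))"]) (auto simp: nat_model_basic)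
    qed
  next
    case 4
    show ?thesis unfolding sat_rule_def
    proof (intro allI impI)
      fix h assume "\<forall>a\<in>set (fst r). map_atom (subst h) a \<in> nat_model n"
      then obtain x w where "h 0 = num x" "h 1 = num w" unfolding 4 by (auto simp: nat_model_basic)
      then show "\<exists>h'. (\<forall>v\<in>body_vars r. h' v = h v) \<and>
        (\<forall>a\<in>set (snd r). map_atom (subst h') a \<in> nat_model n)"
        unfolding 4
        by (intro exI[of _ "h(2 := num (prod_encode (x, w)))"]) (auto simp: nat_model_basic)
    qed
  next
    case 5
    show ?thesis unfolding 5
      by (rule sat_datalogI)
        (use not_halts nat_model_eval1[of q _ "[]"] in \<open>auto simp: nat_model_basic\<close>)
  next
    case 6
    then show ?thesis by (rule nat_model_sat_rules)
  next
    case 7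
    \<comment> \<open>Vacuous, as the body contains a \<open>haltP\<close> atom.\<close>
    show ?thesis unfolding 7 sat_rule_def collapse_rule_def by (simp add: nat_model_basic)
  qed
qed

text \<open>The standard model has atoms for every recursive function and must be cut down to a
  finite signature; heads over that signature survive.\<close>

lemma sat_rule_restrict:
  assumes "sat_rule I r" "\<And>a. a \<in> set (snd r) \<Longrightarrow> fst a \<in> \<Sigma>"
  shows "sat_rule {a \<in> I. fst a \<in> \<Sigma>} r"
  using assms unfolding sat_rule_def map_atom_def by simp

text \<open>Representatives \<open>u m\<close> of the numbers in a universal model are kept apart by
  the homomorphism \<open>h\<close> into the standard model. As \<open>h\<close> also bounds which
  of them are joined to a vertex, \<open>no_pair_vertices\<close> applies to their images in the
  tree.\<close>

lemma nonhalting_not_finite_partitionwidth_set: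
  assumes not_halts: "\<not> reval q [n] 0"
  shows "\<not> finite_partitionwidth_set (set (input_rule n # program q))"
proof
  let ?R = "set (input_rule n # program q)" and ?\<Sigma> = "set (preds q)"
  define M where "M = {a \<in> nat_model n. fst a \<in> ?\<Sigma>}"
  assume "finite_partitionwidth_set ?R"
  moreover have "database ?\<Sigma> ({} :: nat gterm atom set)" by (simp add: database_def terms_of_def)
  ultimately obtain U :: "nat gterm atom set" where
    univ: "universal_model ?\<Sigma> {} ?R U" and fpw: "finite_partitionwidth ?\<Sigma> U"
    using program_signature(1)[of q] program_signature(2)[of q n] unfolding finite_partitionwidth_set_def by blast
  interpret program_model ?\<Sigma> "{}" U q n
    using univ unfolding universal_model_def by unfold_locales blast
  have "is_model ?\<Sigma> {} ?R M"
    unfolding is_model_def inst_over_def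
  proof (intro conjI ballI)
    show "atom_over ?\<Sigma> a" if "a \<in> M" for a
      using that nat_model_arity unfolding M_def atom_over_def by blast
    show "(Top, [t]) \<in> M" if "t \<in> terms_of M" for t
    proof -
      have "t \<in> terms_of (nat_model n)" using that unfolding M_def terms_of_def by blast
      then show ?thesis using nat_model_terms preds_special[of q] by (simp add: M_def)
    qed
    show "sat_rule M r" if "r \<in> ?R" for r
      unfolding M_def using nat_model_sat_program[OF not_halts that] program_atoms(2)[OF that]
      by (intro sat_rule_restrict) auto
  qed simp
  then obtain h where h: "homomorphism h U M" using univ unfolding universal_model_def by blast
  have hom: "(P, map h ts) \<in> nat_model n" if "(P, ts) \<in> U" for P ts
    using h that unfolding homomorphism_def map_atom_def M_def by force
  have h_rep: "h e = num m" if "rep U m e" for m e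
    using that
  proof (induction m arbitrary: e)
    case 0
    then show ?case using hom[of zeroP "[e]"] by (simp add: nat_model_basic)
  next
    case (Suc m)
    then obtain e' where "h e' = num m" "(succP, [e', e]) \<in> U" by auto
    then show ?case using hom[of succP "[e', e]"] by (auto simp: nat_model_basic)
  qed
  obtain u where u: "\<And>m. rep U m (u m)" using rep_ex by metis
  have hu: "h (u m) = num m" for m using h_rep u by blast
  have uT: "(Top, [u m]) \<in> U" for m using rep_top u by blast
  have u_terms: "u m \<in> terms_of U" for m using uT[of m] unfolding terms_of_def by force
  obtain L T where "color_set ?\<Sigma> L" "well_decorated ?\<Sigma> L T"
    and iso: "isomorphic U (tree_instance L T)"
    using fpw unfolding finite_partitionwidth_def by blast
  then interpret decorated_tree ?\<Sigma> L T by unfold_locales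
  let ?J = "tree_instance L T"
  obtain f where f: "bij_betw f (terms_of U) (terms_of ?J)" and img: "map_atom f ` U = ?J"
    using iso unfolding isomorphic_def by blast
  have f_eq: "s = t" if "f s = f t" "s \<in> terms_of U" "t \<in> terms_of U" for s t
    using f that unfolding bij_betw_def inj_on_def by blast
  show False
  proof (rule no_pair_vertices)
    have "inj (\<lambda>m. f (u m))"
    proof (rule injI)
      fix a b assume "f (u a) = f (u b)"
      then have "u a = u b" using f_eq u_terms by blast
      then have "num a = num b" using hu by metis
      then show "a = b" by simp
    qed
    then show "infinite (range (\<lambda>m. f (u m)))" using finite_imageD infinite_UNIV_nat by blast
    show "range (\<lambda>m. f (u m)) \<subseteq> terms_of ?J"
      using f u_terms unfolding bij_betw_def by blast
    fix x w assume "x \<in> range (\<lambda>m. f (u m))" "w \<in> range (\<lambda>m. f (u m))" "x \<noteq> w"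
    then obtain a b where ab: "x = f (u a)" "w = f (u b)" "a \<noteq> b" by blast
    obtain z where z: "(edgeP, [u a, z]) \<in> U" "(edgeP, [u b, z]) \<in> U"
      using edge_ex[OF uT uT] by blast
    have zT: "z \<in> terms_of U" using z(1) unfolding terms_of_def by force
    have edge: "c = fst (prod_decode k) \<or> c = snd (prod_decode k)"
      if "(edgeP, [u c, z]) \<in> U" "h z = num k" for c k
      using hom[OF that(1)] that(2) by (auto simp: nat_model_basic hu)
    obtain k where k: "h z = num k" using hom[OF z(1)] by (auto simp: nat_model_basic)
    \<comment> \<open>\<open>a\<close> and \<open>b\<close> are distinct, so they are the two
      components of \<open>k\<close>, which leaves no room for a third.\<close>
    have only: "c = a \<or> c = b" if "(edgeP, [u c, z]) \<in> U" for c
      using edge[OF that k] edge[OF z(1) k] edge[OF z(2) k] ab(3) by auto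
    have "(edgeP, [x, f z]) \<in> ?J" "(edgeP, [w, f z]) \<in> ?J"
      unfolding img[symmetric] ab using z[THEN imageI, of "map_atom f"] by simp_all
    moreover have "y = x \<or> y = w"
      if y: "y \<in> range (\<lambda>m. f (u m))" "(edgeP, [y, f z]) \<in> ?J" for y
    proof -
      obtain c where c: "y = f (u c)" using y(1) by blast
      \<comment> \<open>An edge of the tree instance comes from an edge of \<open>U\<close>, whose
        ends are \<open>u c\<close> and \<open>z\<close> because \<open>f\<close> is injective on
        terms.\<close>
      obtain p r where pr: "(edgeP, [p, r]) \<in> U" "f p = y" "f r = f z"
        using y(2) unfolding img[symmetric] map_atom_def by auto
      have "p \<in> terms_of U" "r \<in> terms_of U" using pr(1) unfolding terms_of_def by force+
      then have "p = u c" "r = z" using f_eq u_terms zT pr(2,3) c by blast+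
      with pr(1) only have "c = a \<or> c = b" by blast
      with c ab show ?thesis by blast
    qed
    ultimately show "\<exists>z. (edgeP, [x, z]) \<in> ?J \<and> (edgeP, [w, z]) \<in> ?J \<and>
      (\<forall>y\<in>range (\<lambda>m. f (u m)). (edgeP, [y, z]) \<in> ?J \<longrightarrow> y = x \<or> y = w)"
      by blast
  qed
qed

theorem mainTheorem15:
  shows "\<not> decidable ruleset_code {rs. ruleset (set rs)}
    (\<lambda>rs. finite_partitionwidth_set (set rs))"
proof
  assume "decidable ruleset_code {rs. ruleset (set rs)}
    (\<lambda>rs. finite_partitionwidth_set (set rs))"
  then obtain f where f: "\<And>rs. ruleset (set rs) \<Longrightarrow>
      reval f [ruleset_code rs] (if finite_partitionwidth_set (set rs) then 1 else 0)"
    unfolding decidable_def by blast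
  obtain d where d: "\<And>b. reval d [b] (Suc (prod_encode (rule_code (input_rule b), b)))"
    using computable_cons_input_rule by blast
  define q where "q = Comp f [d]"
  \<comment> \<open>\<open>program q\<close> does not contain the input, so \<open>b\<close> is
    defined without circularity. Since \<open>d\<close> maps \<open>b\<close> to the code of
    \<open>?rs\<close>, the value of \<open>q\<close> on \<open>b\<close> is the verdict on
    \<open>?rs\<close>.\<close>
  define b where "b = ruleset_code (program q)"
  let ?rs = "input_rule b # program q"
  have "ruleset (set ?rs)" unfolding ruleset_def using program_signature(1)[of q] program_signature(2)[of q b] by blast
  note f' = f[OF this]
  have code: "ruleset_code ?rs = Suc (prod_encode (rule_code (input_rule b), b))"
    by (simp add: ruleset_code_def b_def)
  have "reval (Comp f [d]) [b] (if finite_partitionwidth_set (set ?rs) then 1 else 0)"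
  proof (rule reval.comp)
    show "list_all2 (\<lambda>g y. reval g [b] y) [d] [ruleset_code ?rs]" using d code by simp
  qed (rule f')
  then have q: "reval q [b] (if finite_partitionwidth_set (set ?rs) then 1 else 0)"
    by (simp only: q_def)
  show False
  \<comment> \<open>Either verdict is wrong: 1 excludes the value 0, so nothing collapses, while 0
    causes the collapse.\<close>
  proof (cases "finite_partitionwidth_set (set ?rs)")
    case True
    then have "\<not> reval q [b] 0" using q reval_functional by fastforce
    with True nonhalting_not_finite_partitionwidth_set show False by blast
  next
    case False
    with q have "reval q [b] 0" by simp
    with False halting_finite_partitionwidth_set show False by blast
  qed
qed

end
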